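(* Let $\Delta$ be a shellable simplicial complex on the vertex set $[n]=\{1,\dots,n\}$ with $\dim\Delta\le n-3$. Then the intersection lattice $L_\Delta$ of the diagonal arrangement $\mathcal{A}_\Delta$ is homotopy equivalent to a wedge of spheres (i.e. the order complex of $L_\Delta-\{\hat 0,\hat 1\}$ has the homotopy type of a wedge of spheres, not necessarily all of the same dimension).
   Context: For $S\subseteq[n]$, $U_S\subseteq\mathbb{R}^n$ denotes the diagonal subspace $\{u: u_i=u_j \text{ for all } i,j\in S\}$. For a simplicial complex $\Delta$ on $[n]$ with $\dim\Delta\le n-3$, $\mathcal{A}_\Delta=\{U_{[n]-F}: F \text{ a facet of }\Delta\}$. The intersection lattice $L_\Delta$ is the set of all intersections of subspaces of $\mathcal{A}_\Delta$ (including the empty intersection $\mathbb{R}^n$, the bottom element $\hat 0$), ordered by reverse inclusion; its top element $\hat 1$ is the intersection of all subspaces. Topological statements about a lattice refer to the order complex (simplicial complex of chains) of its proper part $L-\{\hat0,\hat1\}$. A simplicial complex is shellable if its facets can be ordered $F_1,\dots,F_q$ so that for each $k\ge2$, $(\bigcup_{i<k}2^{F_i})\cap 2^{F_k}$ is pure of dimension $\dim F_k-1$ (facets may have different dimensions). *)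

theory Defs
  imports "HOL-Analysis.Analysis"
begin

definition simplicial_complex_on :: "nat \<Rightarrow> nat set set \<Rightarrow> bool" where
  "simplicial_complex_on n \<Delta> \<longleftrightarrow> \<Delta> \<noteq> {} \<and> (\<forall>F\<in>\<Delta>. F \<subseteq> {1..n})
     \<and> (\<forall>F\<in>\<Delta>. \<forall>G. G \<subseteq> F \<longrightarrow> G \<in> \<Delta>)"

definition facets :: "'a set set \<Rightarrow> 'a set set" where
  "facets K = {F\<in>K. \<forall>G\<in>K. F \<subseteq> G \<longrightarrow> G = F}"

definition cx_dim_le :: "'a set set \<Rightarrow> int \<Rightarrow> bool" where
  "cx_dim_le K d \<longleftrightarrow> (\<forall>F\<in>K. int (card F) - 1 \<le> d)"

definition pure_of_dim :: "'a set set \<Rightarrow> int \<Rightarrow> bool" where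
  "pure_of_dim K d \<longleftrightarrow> (\<forall>F\<in>facets K. int (card F) - 1 = d)"

text \<open>Shellability (facets possibly of different dimensions). List index k >= 1
  corresponds to the paper's k >= 2.\<close>
definition shellable :: "'a set set \<Rightarrow> bool" where
  "shellable K \<longleftrightarrow> (\<exists>fs. distinct fs \<and> set fs = facets K \<and>
     (\<forall>k. 1 \<le> k \<and> k < length fs \<longrightarrow>
        pure_of_dim ((\<Union>i<k. Pow (fs ! i)) \<inter> Pow (fs ! k))
                    (int (card (fs ! k)) - 1 - 1)))"

definition Rn :: "nat \<Rightarrow> (nat \<Rightarrow> real) set" where
  "Rn n = {u. \<forall>i. i \<notin> {1..n} \<longrightarrow> u i = 0}"

definition diag_subspace :: "nat \<Rightarrow> nat set \<Rightarrow> (nat \<Rightarrow> real) set" where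
  "diag_subspace n S = {u \<in> Rn n. \<forall>i\<in>S. \<forall>j\<in>S. u i = u j}"

definition diag_arrangement :: "nat \<Rightarrow> nat set set \<Rightarrow> (nat \<Rightarrow> real) set set" where
  "diag_arrangement n \<Delta> = (\<lambda>F. diag_subspace n ({1..n} - F)) ` facets \<Delta>"

text \<open>All intersections of subfamilies (empty intersection = R^n).\<close>
definition intersection_lattice :: "nat \<Rightarrow> nat set set \<Rightarrow> (nat \<Rightarrow> real) set set" where
  "intersection_lattice n \<Delta> = {Rn n \<inter> \<Inter> B | B. B \<subseteq> diag_arrangement n \<Delta>}"

definition lattice_bot :: "nat \<Rightarrow> (nat \<Rightarrow> real) set" where
  "lattice_bot n = Rn n"

definition lattice_top :: "nat \<Rightarrow> nat set set \<Rightarrow> (nat \<Rightarrow> real) set" where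
  "lattice_top n \<Delta> = Rn n \<inter> \<Inter> (diag_arrangement n \<Delta>)"

definition proper_part :: "nat \<Rightarrow> nat set set \<Rightarrow> (nat \<Rightarrow> real) set set" where
  "proper_part n \<Delta> = intersection_lattice n \<Delta> - {lattice_bot n, lattice_top n \<Delta>}"

definition order_complex :: "'a set \<Rightarrow> ('a \<Rightarrow> 'a \<Rightarrow> bool) \<Rightarrow> 'a set set" where
  "order_complex P le = {C. C \<subseteq> P \<and> finite C \<and> (\<forall>x\<in>C. \<forall>y\<in>C. le x y \<or> le y x)}"

text \<open>Geometric realization of a finite simplicial complex K with vertex set V,
  as barycentric-coordinate functions (product topology on 'a => real).\<close>
definition geom_realization :: "'a set \<Rightarrow> 'a set set \<Rightarrow> ('a \<Rightarrow> real) set" where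
  "geom_realization V K = {x. (\<forall>v. 0 \<le> x v) \<and> (\<forall>v. v \<notin> V \<longrightarrow> x v = 0)
       \<and> sum x V = 1 \<and> {v. x v \<noteq> 0} \<in> K}"

text \<open>The j-th sphere of dimension d: unit sphere in the coordinates (j,0..d)
  centred at e_(j,0), so it passes through the origin; distinct blocks meet only at 0.\<close>
definition block_sphere :: "nat \<Rightarrow> nat \<Rightarrow> (nat \<times> nat \<Rightarrow> real) set" where
  "block_sphere j d = {x. (\<Sum>i\<le>d. (x (j,i) - (if i = 0 then 1 else 0))^2) = 1
       \<and> (\<forall>a b. (a \<noteq> j \<or> b > d) \<longrightarrow> x (a,b) = 0)}"

text \<open>Wedge of spheres of dimensions ds (a point if ds = []).\<close>
definition wedge_spheres :: "nat list \<Rightarrow> (nat \<times> nat \<Rightarrow> real) topology" where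
  "wedge_spheres ds = top_of_set (insert (\<lambda>_. 0) (\<Union>j<length ds. block_sphere j (ds ! j)))"

text \<open>Homotopy equivalent to a wedge of spheres; the empty space counts as the (-1)-sphere.\<close>
definition htype_wedge_of_spheres :: "'a topology \<Rightarrow> bool" where
  "htype_wedge_of_spheres X \<longleftrightarrow> topspace X = {} \<or>
     (\<exists>ds. X homotopy_equivalent_space wedge_spheres ds)"

end

theory Submission
  imports Defs
begin

text \<open>
  Lattices of subspaces are treated in the inclusion order, i.e. upside down: joins of the
  intersection lattice are meets here, and its atoms \<open>U\<^bsub>[n]-F\<^esub>\<close> lie directly below its bottom
  \<open>\<real>\<^sup>n\<close>.

  In terms of the complements \<open>A = [n] - F\<close> of the facets, shellability says that for all \<open>A\<close> before
  \<open>S\<close> there is some \<open>B\<close> before \<open>S\<close> such that \<open>B - S\<close> is a singleton contained in \<open>A\<close>.  The interval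
  above the atom \<open>U\<^bsub>S\<^esub>\<close> is obtained by contracting \<open>S\<close> to a point \<open>v\<close>; the complements before \<open>S\<close> then
  give rise to those of them that are disjoint from \<open>S\<close> and to edges \<open>{v, w}\<close>, a family with the same
  property.  Hence the atoms admit a recursive ordering.

  Adding the atoms one at a time, one finds a set of maximal chains whose removal makes the order
  complex of the proper part nonevasive.  When the last atom \<open>a\<close> is added, the poset without \<open>a\<close> and
  the link of \<open>a\<close> retract, by closure operators, to posets that are covered by the induction
  hypothesis.  The two sets of removed chains fit together because the chains removed earlier are
  maximal in the whole lattice, so that none of them lies in the link of \<open>a\<close>.

  Collapsing a contractible subcomplex to a point is a homotopy equivalence.  This shows that
  nonevasive complexes are contractible, and then that the order complex is homotopy equivalent to its
  quotient by what is left after the removal; as the removed simplices are facets, this quotient is a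
  wedge of simplices modulo their boundaries.
\<close>

section \<open>Almost nonevasive posets\<close>

inductive nonevasive :: "'a set set \<Rightarrow> bool" where
  point: "nonevasive {{}, {x}}"
| attach_cone: "nonevasive K \<Longrightarrow> nonevasive J \<Longrightarrow> J \<subseteq> K \<Longrightarrow> x \<notin> \<Union>K \<Longrightarrow> nonevasive (K \<union> insert x ` J)"

abbreviation (input) order_chains :: "'a::order set \<Rightarrow> 'a set set" where
  "order_chains P \<equiv> order_complex P (\<lambda>x y. y \<le> x)"

definition link :: "'a::order set \<Rightarrow> 'a \<Rightarrow> 'a set" where
  "link P x = {y\<in>P. y < x \<or> x < y}"

definition maximal_chain_in :: "'a::order set \<Rightarrow> 'a set \<Rightarrow> bool" where
  "maximal_chain_in Q C \<longleftrightarrow> (\<forall>z\<in>Q. \<not> C \<subseteq> link UNIV z)"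

text \<open>If \<open>Q\<close> is empty, then so is \<open>P\<close> (in all uses \<open>P \<subseteq> Q\<close>), the only chain is the empty one, and
  nothing is left after its removal.\<close>
definition almost_nonevasive :: "'a::order set \<Rightarrow> 'a set \<Rightarrow> bool" where
  "almost_nonevasive Q P \<longleftrightarrow> Q = {} \<or>
     (\<exists>\<C> \<subseteq> order_chains P. (\<forall>C\<in>\<C>. maximal_chain_in Q C) \<and> nonevasive (order_chains P - \<C>))"

lemma link_mono: "P \<subseteq> Q \<Longrightarrow> link P x \<subseteq> link Q x"
  by (auto simp: link_def)

lemma order_chains_empty: "order_chains {} = {{}}"
  by (auto simp: order_complex_def)

lemma order_chains_insert:
  assumes "x \<notin> P"
  shows "order_chains (insert x P) = order_chains P \<union> insert x ` order_chains (link P x)"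
proof (intro Set.equalityI subsetI)
  fix C assume C: "C \<in> order_chains (insert x P)"
  show "C \<in> order_chains P \<union> insert x ` order_chains (link P x)"
  proof (cases "x \<in> C")
    case True
    then have "C = insert x (C - {x})" by blast
    moreover have "C - {x} \<in> order_chains (link P x)"
      using C True by (auto simp: order_complex_def link_def order.order_iff_strict)
    ultimately show ?thesis by blast
  qed (use C in \<open>auto simp: order_complex_def\<close>)
qed (auto simp: order_complex_def link_def)

lemma nonevasive_order_chains_insert:
  assumes x: "x \<notin> P"
    and \<C>: "\<C> \<subseteq> order_chains P" "\<And>C. C \<in> \<C> \<Longrightarrow> \<not> C \<subseteq> link UNIV x"
    and \<D>: "\<D> \<subseteq> order_chains (link P x)"
    and P: "nonevasive (order_chains P - \<C>)" and L: "nonevasive (order_chains (link P x) - \<D>)"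
  shows "nonevasive (order_chains (insert x P) - (\<C> \<union> insert x ` \<D>))"
proof -
  have x_notin: "x \<notin> C" if "C \<in> order_chains P \<or> C \<in> order_chains (link P x)" for C
    using that x by (auto simp: order_complex_def link_def)
  then have disjoint: "insert x ` S \<inter> order_chains P = {}" for S by blast
  have "inj_on (insert x) (order_chains (link P x))"
    using x_notin by (auto intro!: inj_onI dest: insert_ident[THEN iffD1, rotated 2])
  then have "insert x ` order_chains (link P x) - insert x ` \<D> =
      insert x ` (order_chains (link P x) - \<D>)"
    using \<D> by (simp add: inj_on_image_set_diff)
  moreover have "order_chains P - (\<C> \<union> insert x ` \<D>) = order_chains P - \<C>"
    using disjoint[of \<D>] by blast
  moreover have "insert x ` order_chains (link P x) - (\<C> \<union> insert x ` \<D>) =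
      insert x ` order_chains (link P x) - insert x ` \<D>"
    using disjoint[of "order_chains (link P x)"] \<C>(1) by blast
  ultimately have "order_chains (insert x P) - (\<C> \<union> insert x ` \<D>) =
      (order_chains P - \<C>) \<union> insert x ` (order_chains (link P x) - \<D>)"
    unfolding order_chains_insert[OF x] Un_Diff by simp
  moreover have "order_chains (link P x) - \<D> \<subseteq> order_chains P - \<C>"
    using \<C>(2) by (force simp: order_complex_def link_def)
  moreover have "x \<notin> \<Union>(order_chains P - \<C>)" using x_notin by blast
  ultimately show ?thesis using nonevasive.attach_cone[OF P L] by simp
qed

lemma nonevasive_order_chains_cone:
  assumes "finite S" "S \<subseteq> link UNIV p"
  shows "nonevasive (order_chains (insert p S))"
  using assms
proof (induction S rule: finite_psubset_induct)
  case (psubset S)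
  show ?case
  proof (cases "S = {}")
    case True
    have "order_chains {p} = {{}, {p}}" by (auto simp: order_complex_def subset_singleton_iff)
    then show ?thesis using True by (simp add: nonevasive.point)
  next
    case False
    then obtain x where x: "x \<in> S" by blast
    define R where "R = insert p (S - {x})"
    have "x \<noteq> p" using x psubset.prems by (auto simp: link_def)
    then have R: "x \<notin> R" "insert x R = insert p S" using x by (auto simp: R_def)
    have "link R x = insert p (link (S - {x}) x)"
      using x psubset.prems by (auto simp: R_def link_def)
    moreover have "link (S - {x}) x \<subset> S" "link (S - {x}) x \<subseteq> link UNIV p"
      using x psubset.prems by (auto simp: link_def)
    ultimately have "nonevasive (order_chains (link R x))" using psubset.IH by simp
    moreover have "nonevasive (order_chains R)"
      unfolding R_def using psubset.IH[of "S - {x}"] x psubset.prems by auto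
    ultimately show ?thesis
      using nonevasive_order_chains_insert[OF R(1), of "{}" "{}"] R(2) by simp
  qed
qed

lemma almost_nonevasive_cone:
  assumes "finite P" "p \<in> P" "P - {p} \<subseteq> link UNIV p"
  shows "almost_nonevasive Q P"
proof -
  have "nonevasive (order_chains P)"
    using nonevasive_order_chains_cone[of "P - {p}" p] assms by (simp add: insert_absorb)
  then show ?thesis unfolding almost_nonevasive_def by (intro disjI2 exI[of _ "{}"]) simp
qed

lemma almost_nonevasive_insert:
  assumes x: "x \<in> Q" "x \<notin> P" and "P \<subseteq> Q"
    and P: "almost_nonevasive Q P" and L: "almost_nonevasive (link Q x) (link P x)"
  shows "almost_nonevasive Q (insert x P)"
proof -
  obtain \<C> where \<C>: "\<C> \<subseteq> order_chains P" "\<And>C. C \<in> \<C> \<Longrightarrow> maximal_chain_in Q C"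
    "nonevasive (order_chains P - \<C>)"
    using P x unfolding almost_nonevasive_def by blast
  have not_link: "\<not> C \<subseteq> link UNIV x" if "C \<in> \<C>" for C
    using \<C>(2)[OF that] x(1) by (auto simp: maximal_chain_in_def)
  have "\<exists>\<D> \<subseteq> order_chains (link P x). (\<forall>D\<in>\<D>. maximal_chain_in (link Q x) D) \<and>
      nonevasive (order_chains (insert x P) - (\<C> \<union> insert x ` \<D>))"
  proof (cases "link Q x = {}")
    case True
    then have "link P x = {}" using link_mono[OF \<open>P \<subseteq> Q\<close>, of x] by blast
    moreover have "{x} \<notin> order_chains P" using x by (auto simp: order_complex_def)
    then have "order_chains P \<union> {{x}} - insert {x} \<C> = order_chains P - \<C>" by blast
    ultimately show ?thesis
      using True \<C>(3) order_chains_insert[OF x(2)]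
      by (intro exI[of _ "{{}}"]) (simp add: order_chains_empty maximal_chain_in_def)
  next
    case False
    then obtain \<D> where "\<D> \<subseteq> order_chains (link P x)" "\<forall>D\<in>\<D>. maximal_chain_in (link Q x) D"
      "nonevasive (order_chains (link P x) - \<D>)"
      using L unfolding almost_nonevasive_def by blast
    then show ?thesis
      using nonevasive_order_chains_insert[OF x(2) \<C>(1) not_link _ \<C>(3)] by blast
  qed
  then obtain \<D> where \<D>: "\<D> \<subseteq> order_chains (link P x)" "\<And>D. D \<in> \<D> \<Longrightarrow> maximal_chain_in (link Q x) D"
    "nonevasive (order_chains (insert x P) - (\<C> \<union> insert x ` \<D>))" by blast
  moreover have "\<C> \<union> insert x ` \<D> \<subseteq> order_chains (insert x P)"
    unfolding order_chains_insert[OF x(2)] using \<C>(1) \<D>(1) by blast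
  moreover have "maximal_chain_in Q (insert x D)" if "D \<in> \<D>" for D
    using \<D>(2)[OF that] by (fastforce simp: maximal_chain_in_def link_def)
  ultimately show ?thesis
    unfolding almost_nonevasive_def using \<C>(2) by (intro disjI2 exI[of _ "\<C> \<union> insert x ` \<D>"]) blast
qed

lemma almost_nonevasive_closure:
  assumes "finite X" "P \<subseteq> X" "X \<subseteq> Q" and P: "almost_nonevasive Q P"
    and f: "f ` X \<subseteq> P" "\<And>x. x \<in> X \<Longrightarrow> x \<le> f x" "\<And>x. x \<in> P \<Longrightarrow> f x = x" "mono_on X f"
  shows "almost_nonevasive Q X"
  using assms(1-3) f
proof (induction X rule: finite_psubset_induct)
  case (psubset X)
  show ?case
  proof (cases "X = P")
    case False
    then have "finite (X - P)" "X - P \<noteq> {}" using psubset by auto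
    then obtain x where x: "x \<in> X" "x \<notin> P" and max: "\<And>y. y \<in> X - P \<Longrightarrow> \<not> x < y"
      by (metis DiffE finite_has_maximal order_less_le)
    define R where "R = X - {x}"
    have R: "x \<notin> R" "insert x R = X" "R \<subset> X" "P \<subseteq> R" "R \<subseteq> Q" "f ` R \<subseteq> P"
      using x psubset.prems by (auto simp: R_def)
    have "x \<le> f x" "f x \<in> P" using x psubset.prems by auto
    then have "f x \<in> R" "x < f x" using x R by (auto simp: order.strict_iff_order)
    have "mono_on R f" using psubset.prems(6) R by (auto intro: mono_on_subset)
    then have "almost_nonevasive Q R" using psubset.IH[OF R(3-6)] psubset.prems R by blast
    moreover have "almost_nonevasive (link Q x) (link R x)"
    proof (rule almost_nonevasive_cone)
      show "finite (link R x)" using psubset.hyps by (simp add: link_def R_def)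
      show "f x \<in> link R x" using \<open>f x \<in> R\<close> \<open>x < f x\<close> by (simp add: link_def)
      show "link R x - {f x} \<subseteq> link UNIV (f x)"
      proof
        fix y assume y: "y \<in> link R x - {f x}"
        then consider (below) "y < x" | (above) "x < y" "y \<in> X" by (auto simp: link_def R_def)
        then show "y \<in> link UNIV (f x)"
        proof cases
          case below
          then show ?thesis using \<open>x < f x\<close> by (auto simp: link_def)
        next
          case above
          then have "f y = y" using max psubset.prems(5) by blast
          moreover have "f x \<le> f y" using mono_onD[OF psubset.prems(6)] x above by simp
          ultimately show ?thesis using y by (auto simp: link_def order.order_iff_strict)
        qed
      qed
    qed
    ultimately have "almost_nonevasive Q (insert x R)"
      using R x psubset.prems(2) by (intro almost_nonevasive_insert) auto
    then show ?thesis using R(2) by simp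
  qed (use P in simp)
qed

section \<open>Shelled lattices\<close>

definition meets :: "'a::complete_lattice \<Rightarrow> 'a set \<Rightarrow> 'a set" where
  "meets b A = {inf b (Inf B) | B. B \<subseteq> A}"

definition inner_meets :: "'a::complete_lattice \<Rightarrow> 'a set \<Rightarrow> 'a set" where
  "inner_meets b A = meets b A - {b, inf b (Inf A)}"

definition meet_above :: "'a::complete_lattice \<Rightarrow> 'a set \<Rightarrow> 'a \<Rightarrow> 'a" where
  "meet_above b A x = inf b (Inf {a\<in>A. x \<le> a})"

lemma meetsI: "B \<subseteq> A \<Longrightarrow> x = inf b (Inf B) \<Longrightarrow> x \<in> meets b A"
  by (auto simp: meets_def)

lemma meetsE:
  assumes "x \<in> meets b A"
  obtains B where "B \<subseteq> A" "x = inf b (Inf B)"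
  using assms by (auto simp: meets_def)

lemma meets_le: "x \<in> meets b A \<Longrightarrow> x \<le> b"
  by (auto elim: meetsE)

lemma meets_ge: "x \<in> meets b A \<Longrightarrow> inf b (Inf A) \<le> x"
  by (elim meetsE) (simp add: Inf_superset_mono le_infI2)

lemma base_in_meets: "b \<in> meets b A"
  by (rule meetsI[of "{}"]) auto

lemma bottom_in_meets: "inf b (Inf A) \<in> meets b A"
  by (rule meetsI[OF subset_refl refl])

lemma generator_in_meets: "a \<in> A \<Longrightarrow> a \<le> b \<Longrightarrow> a \<in> meets b A"
  by (rule meetsI[of "{a}"]) (auto simp: inf.absorb2)

lemma finite_meets: "finite A \<Longrightarrow> finite (meets b A)"
  unfolding meets_def by simp

lemma meets_subset_meets:
  assumes "c \<in> meets b A" "B \<subseteq> meets b A"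
  shows "meets c B \<subseteq> meets b A"
proof
  fix x assume "x \<in> meets c B"
  then obtain D where D: "D \<subseteq> B" "x = inf c (Inf D)" by (rule meetsE)
  obtain S where S: "S \<subseteq> A" "c = inf b (Inf S)" using assms(1) by (rule meetsE)
  have "\<forall>d\<in>D. \<exists>T\<subseteq>A. d = inf b (Inf T)" using D assms(2) by (auto simp: meets_def)
  then obtain T where T: "\<And>d. d \<in> D \<Longrightarrow> T d \<subseteq> A \<and> d = inf b (Inf (T d))" by metis
  have "y \<le> x \<longleftrightarrow> y \<le> inf b (Inf (S \<union> \<Union>(T ` D)))" for y
  proof -
    have "y \<le> x \<longleftrightarrow> y \<le> b \<and> y \<le> Inf S \<and> (\<forall>d\<in>D. y \<le> d)" by (simp add: D(2) S(2) le_Inf_iff)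
    also have "\<dots> \<longleftrightarrow> y \<le> b \<and> y \<le> Inf S \<and> (\<forall>d\<in>D. y \<le> Inf (T d))" using T by (metis le_inf_iff)
    also have "\<dots> \<longleftrightarrow> y \<le> inf b (Inf (S \<union> \<Union>(T ` D)))" by (auto simp: le_Inf_iff)
    finally show ?thesis .
  qed
  then have "x = inf b (Inf (S \<union> \<Union>(T ` D)))" by (meson order_antisym order_refl)
  then show "x \<in> meets b A" using S T by (intro meetsI[of "S \<union> \<Union>(T ` D)"]) auto
qed

lemma meets_insert:
  assumes "a \<le> b"
  shows "meets b (insert a A) = meets b A \<union> meets a A"
proof (intro Set.equalityI subsetI)
  fix x assume "x \<in> meets b (insert a A)"
  then obtain B where B: "B \<subseteq> insert a A" "x = inf b (Inf B)" by (rule meetsE)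
  show "x \<in> meets b A \<union> meets a A"
  proof (cases "a \<in> B")
    case True
    then have "Inf B = inf a (Inf (B - {a}))"
      using complete_lattice_class.Inf_insert[of a "B - {a}"] by (simp add: insert_absorb)
    then have "x = inf a (Inf (B - {a}))"
      using B(2) assms by (simp add: inf.absorb2 flip: inf_assoc)
    then show ?thesis using B(1) meetsI[of "B - {a}" A] by blast
  next
    case False
    then show ?thesis using B meetsI[of B A] by blast
  qed
next
  fix x assume "x \<in> meets b A \<union> meets a A"
  then consider (above) "x \<in> meets b A" | (below) "x \<in> meets a A" by blast
  then show "x \<in> meets b (insert a A)"
  proof cases
    case above
    then show ?thesis by (elim meetsE) (auto intro: meetsI)
  next
    case below
    then obtain B where "B \<subseteq> A" "x = inf a (Inf B)" by (rule meetsE)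
    then show ?thesis
      using assms by (intro meetsI[of "insert a B"]) (auto simp: inf.absorb2 simp flip: inf_assoc)
  qed
qed

lemma meets_below_generator:
  assumes "x \<in> meets b A" "x \<noteq> b"
  shows "\<exists>a\<in>A. x \<le> a"
proof -
  obtain B where B: "B \<subseteq> A" "x = inf b (Inf B)" using assms(1) by (rule meetsE)
  then have "B \<noteq> {}" using assms(2) by auto
  then obtain a where "a \<in> B" by blast
  then show ?thesis using B by (auto intro!: bexI[of _ a] le_infI2 Inf_lower)
qed

lemma meet_above_in_meets: "meet_above b A x \<in> meets b A"
  unfolding meet_above_def by (rule meetsI) auto

lemma meet_above_ge: "x \<le> b \<Longrightarrow> x \<le> meet_above b A x"
  by (auto simp: meet_above_def le_Inf_iff)

lemma meet_above_le: "a \<in> A \<Longrightarrow> x \<le> a \<Longrightarrow> meet_above b A x \<le> a"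
  by (auto simp: meet_above_def intro: le_infI2 Inf_lower)

lemma mono_meet_above: "mono_on X (meet_above b A)"
  unfolding meet_above_def by (intro mono_onI inf_mono Inf_superset_mono) auto

lemma meet_above_id:
  assumes "x \<in> meets b A"
  shows "meet_above b A x = x"
proof (rule order_antisym)
  obtain B where B: "B \<subseteq> A" "x = inf b (Inf B)" using assms by (rule meetsE)
  then have "B \<subseteq> {a\<in>A. x \<le> a}" by (auto intro: le_infI2 Inf_lower)
  then show "meet_above b A x \<le> x"
    unfolding meet_above_def by (subst (2) B(2)) (intro inf_mono order_refl Inf_superset_mono)
  show "x \<le> meet_above b A x" using meet_above_ge meets_le assms by blast
qed

definition covers :: "'a::order set \<Rightarrow> 'a \<Rightarrow> 'a \<Rightarrow> bool" where
  "covers \<L> b a \<longleftrightarrow> a \<in> \<L> \<and> b \<in> \<L> \<and> a < b \<and> \<L> \<inter> {a<..<b} = {}"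

lemma covers_antichain: "covers \<L> b a \<Longrightarrow> covers \<L> b a' \<Longrightarrow> a \<le> a' \<Longrightarrow> a = a'"
  by (force simp: covers_def order.order_iff_strict)

text \<open>In the reversed order this is a recursive atom ordering of the interval between \<open>b\<close> and
  \<open>inf b (Inf A)\<close>, whose atoms are the elements of \<open>A\<close>.\<close>
inductive shelled :: "'a::complete_lattice set \<Rightarrow> 'a \<Rightarrow> 'a set \<Rightarrow> bool" for \<L> where
  single: "covers \<L> b a \<Longrightarrow> shelled \<L> b {a}"
| insert: "shelled \<L> b A \<Longrightarrow> covers \<L> b a \<Longrightarrow> a \<notin> A \<Longrightarrow> shelled \<L> a B \<Longrightarrow> B \<subseteq> meets b (insert a A) \<Longrightarrow>
    (\<And>a'. a' \<in> A \<Longrightarrow> \<exists>c\<in>B. inf a a' \<le> c) \<Longrightarrow> shelled \<L> b (insert a A)"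

lemma shelled_covers: "shelled \<L> b A \<Longrightarrow> a \<in> A \<Longrightarrow> covers \<L> b a"
  by (induction rule: shelled.induct) auto

lemma shelled_less: "shelled \<L> b A \<Longrightarrow> a \<in> A \<Longrightarrow> a < b"
  using shelled_covers by (auto simp: covers_def)

lemma shelled_nonempty: "shelled \<L> b A \<Longrightarrow> A \<noteq> {}"
  by (induction rule: shelled.induct) auto

lemma almost_nonevasive_below_generators:
  assumes A: "A \<noteq> {}" "\<And>a. a \<in> A \<Longrightarrow> a < b"
    and inner: "almost_nonevasive (\<L> \<inter> {inf b (Inf A)<..<b}) (inner_meets b A)"
    and X: "finite X" "meets b A - {b, m} \<subseteq> X" "X \<subseteq> \<L> \<inter> {m<..<b}"
      "\<And>x. x \<in> X \<Longrightarrow> \<exists>a\<in>A. x \<le> a"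
  shows "almost_nonevasive (\<L> \<inter> {m<..<b}) X"
proof (rule almost_nonevasive_closure[OF X(1-3)])
  have increasing: "x \<le> meet_above b A x" if "x \<in> X" for x
    using that X(3) by (intro meet_above_ge less_imp_le) auto
  show "almost_nonevasive (\<L> \<inter> {m<..<b}) (meets b A - {b, m})"
  proof (cases "inf b (Inf A) = m")
    case True
    then show ?thesis using inner by (simp add: inner_meets_def)
  next
    case False
    have "inf b (Inf A) < b" using A by (metis Inf_lower ex_in_conv le_infI2 order_le_less_trans)
    show ?thesis
    proof (rule almost_nonevasive_cone)
      show "finite (meets b A - {b, m})" using X(1,2) by (rule finite_subset[rotated])
      show "inf b (Inf A) \<in> meets b A - {b, m}"
        using bottom_in_meets \<open>inf b (Inf A) < b\<close> False by auto
      show "meets b A - {b, m} - {inf b (Inf A)} \<subseteq> link UNIV (inf b (Inf A))"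
        using meets_ge by (fastforce simp: link_def order.order_iff_strict)
    qed
  qed
  show "meet_above b A ` X \<subseteq> meets b A - {b, m}"
  proof (rule image_subsetI)
    fix x assume x: "x \<in> X"
    then obtain a where "a \<in> A" "x \<le> a" using X(4) by blast
    then have "meet_above b A x < b" using meet_above_le A(2) order_le_less_trans by blast
    moreover have "m < x" using x X(3) by auto
    ultimately show "meet_above b A x \<in> meets b A - {b, m}"
      using meet_above_in_meets[of b A x] increasing[OF x] by auto
  qed
  show "x \<le> meet_above b A x" if "x \<in> X" for x using that by (rule increasing)
  show "meet_above b A x = x" if "x \<in> meets b A - {b, m}" for x using that meet_above_id by blast
qed (rule mono_meet_above)

lemma link_interval_below_cover:
  "covers \<L> b a \<Longrightarrow> link (\<L> \<inter> {m<..<b}) a = \<L> \<inter> {m<..<a}"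
  by (auto simp: link_def covers_def)

lemma meet_less_cover:
  fixes a :: "'a::complete_lattice"
  assumes "covers \<L> b a" "covers \<L> b a'" "a' \<in> A" "a \<noteq> a'"
  shows "inf b (Inf (insert a A)) < a"
proof -
  have "inf b (Inf (insert a A)) \<le> inf a a'"
    using assms(3) by (auto intro: le_infI1 le_infI2 Inf_lower)
  also have "\<dots> < a"
    using covers_antichain[OF assms(1,2)] assms(4)
    by (metis inf.cobounded1 inf.cobounded2 order_le_less)
  finally show ?thesis .
qed

lemma meets_insert_below:
  assumes "x \<in> meets b (insert a A)" "a \<le> b" "x \<noteq> a" "x \<noteq> b"
  shows "\<exists>a'\<in>A. x \<le> a'"
  using assms(1,3,4) meets_below_generator unfolding meets_insert[OF assms(2)] by blast

lemma almost_nonevasive_link_cover: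
  assumes a: "covers \<L> b a" "a \<in> meets b (insert a A)"
    and B: "shelled \<L> a B" "B \<subseteq> meets b (insert a A)" "\<And>a'. a' \<in> A \<Longrightarrow> \<exists>c\<in>B. inf a a' \<le> c"
    and inner: "almost_nonevasive (\<L> \<inter> {inf a (Inf B)<..<a}) (inner_meets a B)"
    and X: "X = meets b (insert a A) - {b, m, a}" "finite X" "X \<subseteq> \<L> \<inter> {m<..<b}"
  shows "almost_nonevasive (link (\<L> \<inter> {m<..<b}) a) (link X a)"
  unfolding link_interval_below_cover[OF a(1)]
proof (rule almost_nonevasive_below_generators[OF _ _ inner])
  show "B \<noteq> {}" "\<And>c. c \<in> B \<Longrightarrow> c < a" using shelled_nonempty[OF B(1)] shelled_less[OF B(1)] by blast+
  have "a < b" using a(1) by (simp add: covers_def)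
  have "x < a \<and> x \<noteq> b" if "x \<in> meets a B" "x \<noteq> a" for x
    using that meets_le \<open>a < b\<close> by (metis order_le_less order_less_asym)
  then show "meets a B - {a, m} \<subseteq> link X a"
    using meets_subset_meets[OF a(2) B(2)] by (auto simp: link_def X(1))
  show link_subset: "link X a \<subseteq> \<L> \<inter> {m<..<a}"
    using link_mono[OF X(3)] link_interval_below_cover[OF a(1)] by blast
  fix x assume x: "x \<in> link X a"
  then have "x < a" using link_subset by auto
  moreover obtain a' where "a' \<in> A" "x \<le> a'"
    using meets_insert_below[of x b a A, OF _ less_imp_le[OF \<open>a < b\<close>]] x
    by (auto simp: X(1) link_def)
  ultimately show "\<exists>c\<in>B. x \<le> c" using B(3)[of a'] by (meson le_infI less_imp_le order_trans)
qed (use X(2) in \<open>simp add: link_def\<close>)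

theorem shelled_imp_almost_nonevasive:
  assumes "finite E" "shelled (meets t E) b A"
  shows "almost_nonevasive (meets t E \<inter> {inf b (Inf A)<..<b}) (inner_meets b A)"
  using assms(2)
proof (induction rule: shelled.induct)
  case (single b a)
  then have "meets t E \<inter> {inf b (Inf {a})<..<b} = {}"
    by (simp add: covers_def inf.absorb2 less_imp_le)
  then show ?case by (simp add: almost_nonevasive_def)
next
  case (insert b A a B)
  define m where "m = inf b (Inf (insert a A))"
  let ?M = "meets b (insert a A)" and ?Q = "meets t E \<inter> {m<..<b}"
  define X where "X = ?M - {b, m, a}"
  have "?M \<subseteq> meets t E"
    using insert.hyps(2) shelled_covers[OF insert.hyps(1)]
    by (intro meets_subset_meets) (auto simp: covers_def)
  then have "finite X" using finite_meets[OF assms(1)] by (auto simp: X_def intro: finite_subset)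
  have X_Q: "X \<subseteq> ?Q"
    using \<open>?M \<subseteq> meets t E\<close> meets_le meets_ge by (fastforce simp: X_def m_def order.strict_iff_order)
  have "a < b" using insert.hyps(2) by (simp add: covers_def)
  then have below: "\<exists>a'\<in>A. x \<le> a'" if "x \<in> X" for x
    using that meets_insert_below[of x b a A] by (auto simp: X_def)
  have "a \<in> ?M" using \<open>a < b\<close> by (intro generator_in_meets) auto
  have "m < a"
    using shelled_nonempty[OF insert.hyps(1)] shelled_covers[OF insert.hyps(1)] insert.hyps(2,3)
      meet_less_cover unfolding m_def by (metis ex_in_conv)
  have "almost_nonevasive ?Q X"
  proof (rule almost_nonevasive_below_generators[OF _ _ insert.IH(1) \<open>finite X\<close> _ X_Q below])
    show "A \<noteq> {}" "\<And>a'. a' \<in> A \<Longrightarrow> a' < b"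
      using shelled_nonempty[OF insert.hyps(1)] shelled_less[OF insert.hyps(1)] by blast+
    have "\<not> a \<le> a'" if "a' \<in> A" for a'
      using covers_antichain[OF insert.hyps(2) shelled_covers[OF insert.hyps(1) that]]
        insert.hyps(3) that by blast
    then have "a \<notin> meets b A" using meets_below_generator[of a b A] \<open>a < b\<close> by blast
    then show "meets b A - {b, m} \<subseteq> X" using \<open>a < b\<close> by (auto simp: X_def meets_insert less_imp_le)
  qed
  moreover have "almost_nonevasive (link ?Q a) (link X a)"
    using almost_nonevasive_link_cover insert.hyps(2,4-6) insert.IH(2) \<open>a \<in> ?M\<close> X_def
      \<open>finite X\<close> X_Q by blast
  ultimately have "almost_nonevasive ?Q (insert a X)"
    using X_Q \<open>m < a\<close> \<open>a < b\<close> insert.hyps(2)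
    by (intro almost_nonevasive_insert) (auto simp: X_def covers_def)
  moreover have "insert a X = inner_meets b (insert a A)"
    using \<open>a \<in> ?M\<close> \<open>m < a\<close> \<open>a < b\<close> by (auto simp: X_def inner_meets_def m_def)
  ultimately show ?case by (simp add: m_def)
qed

section \<open>Linear quotients and contraction\<close>

inductive linear_quotients :: "'a set set \<Rightarrow> bool" where
  empty: "linear_quotients {}"
| insert: "linear_quotients \<A> \<Longrightarrow> S \<notin> \<A> \<Longrightarrow> (\<And>A. A \<in> \<A> \<Longrightarrow> \<exists>B\<in>\<A>. \<exists>w\<in>A - S. B - S = {w}) \<Longrightarrow>
    linear_quotients (insert S \<A>)"

definition contract :: "'a set \<Rightarrow> 'a \<Rightarrow> 'a \<Rightarrow> 'a" where
  "contract S v x = (if x \<in> S then v else x)"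

lemma contract_eq_iff: "v \<in> S \<Longrightarrow> contract S v x = contract S v y \<longleftrightarrow> x = y \<or> x \<in> S \<and> y \<in> S"
  by (auto simp: contract_def)

definition contraction :: "'a set \<Rightarrow> 'a \<Rightarrow> 'a set set \<Rightarrow> 'a set set" where
  "contraction S v \<A> = {A\<in>\<A>. A \<inter> S = {}} \<union> (\<lambda>w. {v, w}) ` {w. \<exists>A\<in>\<A>. A - S = {w}}"

lemma contractionE:
  assumes "B \<in> contraction S v \<A>"
  obtains (disjoint) "B \<in> \<A>" "B \<inter> S = {}" | (edge) A w where "A \<in> \<A>" "A - S = {w}" "B = {v, w}"
  using assms by (auto simp: contraction_def)

lemma finite_linear_quotients: "linear_quotients \<A> \<Longrightarrow> finite \<A>"
  by (induction rule: linear_quotients.induct) auto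

lemma linear_quotients_star:
  assumes "finite W" "v \<notin> W"
  shows "linear_quotients ((\<lambda>w. {v, w}) ` W)"
  using assms
proof (induction W)
  case (insert w W)
  have "{v, w} \<notin> (\<lambda>w. {v, w}) ` W" using insert by (auto simp: doubleton_eq_iff)
  moreover have "\<exists>B\<in>(\<lambda>w. {v, w}) ` W. \<exists>w'\<in>A - {v, w}. B - {v, w} = {w'}"
    if "A \<in> (\<lambda>w. {v, w}) ` W" for A
    using that insert by (intro bexI[OF _ that]) auto
  ultimately show ?case using insert by (simp add: linear_quotients.insert)
qed (simp add: linear_quotients.empty)

lemma linear_quotients_disjoint_Un_star:
  assumes "linear_quotients \<A>" "v \<in> S" "finite W" "W \<inter> S = {}" "\<And>A. A \<in> \<A> \<Longrightarrow> A \<inter> W \<noteq> {}"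
  shows "linear_quotients ({A\<in>\<A>. A \<inter> S = {}} \<union> (\<lambda>w. {v, w}) ` W)"
  using assms(1,5)
proof (induction rule: linear_quotients.induct)
  case empty
  then show ?case using linear_quotients_star[of W v] assms(2-4) by auto
next
  case (insert \<A> T)
  let ?\<D> = "{A\<in>\<A>. A \<inter> S = {}} \<union> (\<lambda>w. {v, w}) ` W"
  have IH: "linear_quotients ?\<D>" using insert.IH insert.prems by simp
  show ?case
  proof (cases "T \<inter> S = {}")
    case True
    have quotient: "\<exists>B\<in>?\<D>. \<exists>w\<in>A - T. B - T = {w}" if A: "A \<in> ?\<D>" for A
    proof (cases "A \<in> \<A> \<and> A \<inter> S = {}")
      case True
      then obtain B w where B: "B \<in> \<A>" "w \<in> A - T" "B - T = {w}" using insert.hyps(3)[of A] by blast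
      then have "B \<subseteq> insert w T" "w \<notin> S" using True by auto
      then have "B \<inter> S = {}" using \<open>T \<inter> S = {}\<close> by auto
      then show ?thesis using B by (intro bexI[of _ B] bexI[of _ w]) auto
    next
      case False
      then have v: "v \<in> A - T" using A assms(2) \<open>T \<inter> S = {}\<close> by auto
      obtain w where "w \<in> T" "w \<in> W" using insert.prems by blast
      then show ?thesis using v by (intro bexI[of _ "{v, w}"] bexI[of _ v]) auto
    qed
    have "T \<notin> ?\<D>" using insert.hyps(2) True assms(2) by auto
    then have "linear_quotients (insert T ?\<D>)" using IH quotient by (intro linear_quotients.insert)
    moreover have "{A \<in> insert T \<A>. A \<inter> S = {}} = insert T {A\<in>\<A>. A \<inter> S = {}}" using True by auto
    ultimately show ?thesis by simp
  next
    case False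
    then have "{A \<in> insert T \<A>. A \<inter> S = {}} = {A\<in>\<A>. A \<inter> S = {}}" by auto
    then show ?thesis using IH by simp
  qed
qed

lemma linear_quotients_contraction:
  assumes "linear_quotients \<A>" "v \<in> S" "\<And>A. A \<in> \<A> \<Longrightarrow> \<exists>B\<in>\<A>. \<exists>w\<in>A - S. B - S = {w}"
  shows "linear_quotients (contraction S v \<A>)"
proof -
  let ?W = "{w. \<exists>A\<in>\<A>. A - S = {w}}"
  have "(\<lambda>w. {w}) ` ?W \<subseteq> (\<lambda>A. A - S) ` \<A>" by auto
  then have "finite ((\<lambda>w. {w}) ` ?W)"
    by (rule finite_subset) (simp add: finite_linear_quotients[OF assms(1)])
  then have "finite ?W" by (rule finite_imageD) (simp add: inj_on_def)
  moreover have "A \<inter> ?W \<noteq> {}" if "A \<in> \<A>" for A using assms(3)[OF that] by blast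
  ultimately show ?thesis
    unfolding contraction_def using assms(1,2) by (intro linear_quotients_disjoint_Un_star) auto
qed

lemma image_contract_disjoint: "A \<inter> S = {} \<Longrightarrow> contract S v ` A = A"
  by (force simp: contract_def)

lemma image_contract_edge:
  assumes "v \<in> S" "A - S = {w}" "2 \<le> card A"
  shows "contract S v ` A = {v, w}"
proof -
  have "A \<noteq> {w}" using assms(3) by auto
  then have "A \<inter> S \<noteq> {}" using assms(2) by blast
  then show ?thesis using assms(1,2) by (auto simp: contract_def image_def)
qed

lemma in_contraction_imp_image:
  assumes "B \<in> contraction S v \<A>" "v \<in> S" "\<And>A. A \<in> \<A> \<Longrightarrow> 2 \<le> card A"
  shows "B \<in> image (contract S v) ` \<A>"
  using assms(1)
proof (cases rule: contractionE)
  case disjoint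
  then show ?thesis using image_contract_disjoint[of B S v] by (intro image_eqI[of _ _ B]) auto
next
  case (edge A w)
  then show ?thesis
    using image_contract_edge[OF assms(2) edge(2) assms(3)] by (intro image_eqI[of _ _ A]) auto
qed

lemma contraction_subset_image:
  assumes "A \<in> \<A>" "\<exists>B\<in>\<A>. \<exists>w\<in>A - S. B - S = {w}"
  shows "\<exists>B\<in>contraction S v \<A>. B \<subseteq> contract S v ` A"
proof (cases "A \<inter> S = {}")
  case True
  then show ?thesis using assms(1) image_contract_disjoint[of A S v] by (auto simp: contraction_def)
next
  case False
  obtain w where w: "w \<in> A - S" "{v, w} \<in> contraction S v \<A>"
    using assms(2) by (auto simp: contraction_def)
  then have "{v, w} \<subseteq> contract S v ` A" using False by (auto simp: contract_def image_def)
  then show ?thesis using w(2) by blast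
qed

lemma shelling_step_linear_quotient:
  assumes "finite (fs ! k)" "i < k"
    and pure: "pure_of_dim ((\<Union>i<k. Pow (fs ! i)) \<inter> Pow (fs ! k)) (int (card (fs ! k)) - 1 - 1)"
  shows "\<exists>j<k. \<exists>w. w \<notin> fs ! i \<and> fs ! k - fs ! j = {w}"
proof -
  let ?I = "(\<Union>i<k. Pow (fs ! i)) \<inter> Pow (fs ! k)"
  have "finite ?I" "fs ! i \<inter> fs ! k \<in> ?I" using assms(1,2) by auto
  then obtain H where H: "H \<in> ?I" "fs ! i \<inter> fs ! k \<subseteq> H" "\<And>G. G \<in> ?I \<Longrightarrow> H \<subseteq> G \<Longrightarrow> H = G"
    using finite_has_maximal2[of ?I] by metis
  then have "H \<in> facets ?I" unfolding facets_def by blast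
  then have card: "int (card H) = int (card (fs ! k)) - 1"
    using pure unfolding pure_of_dim_def by fastforce
  obtain j where j: "j < k" "H \<subseteq> fs ! j" "H \<subseteq> fs ! k" using H(1) by blast
  then have "H = fs ! j \<inter> fs ! k" using H(3)[of "fs ! j \<inter> fs ! k"] by auto
  moreover have "card (fs ! k - H) = 1"
    using card j(3) assms(1) by (simp add: card_Diff_subset finite_subset)
  then obtain w where "fs ! k - H = {w}" by (meson card_1_singletonE)
  ultimately have "fs ! k - fs ! j = {w}" "w \<notin> fs ! i" using H(2) by auto
  then show ?thesis using j(1) by blast
qed

lemma shellable_imp_linear_quotients:
  assumes "shellable \<Delta>" and \<Delta>: "\<And>F. F \<in> \<Delta> \<Longrightarrow> F \<subseteq> N" and "finite N"
  shows "linear_quotients ((\<lambda>F. N - F) ` facets \<Delta>)"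
proof -
  obtain fs where fs: "distinct fs" "set fs = facets \<Delta>" "\<And>k. 1 \<le> k \<Longrightarrow> k < length fs \<Longrightarrow>
      pure_of_dim ((\<Union>i<k. Pow (fs ! i)) \<inter> Pow (fs ! k)) (int (card (fs ! k)) - 1 - 1)"
    using assms(1) unfolding shellable_def by blast
  have sub: "fs ! i \<subseteq> N" if "i < length fs" for i
    using that fs(2) \<Delta> by (metis (lifting) facets_def mem_Collect_eq nth_mem)
  have "linear_quotients ((\<lambda>i. N - fs ! i) ` {..<k})" if "k \<le> length fs" for k
    using that
  proof (induction k)
    case (Suc k)
    let ?\<A> = "(\<lambda>i. N - fs ! i) ` {..<k}"
    have "N - fs ! k \<noteq> N - fs ! i" if "i < k" for i
    proof -
      have "fs ! k \<noteq> fs ! i" using nth_eq_iff_index_eq[OF fs(1)] Suc.prems that by simp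
      then show ?thesis using sub[of k] sub[of i] Suc.prems that by auto
    qed
    then have "N - fs ! k \<notin> ?\<A>" by blast
    moreover have "\<exists>B\<in>?\<A>. \<exists>w\<in>A - (N - fs ! k). B - (N - fs ! k) = {w}" if A: "A \<in> ?\<A>" for A
    proof -
      obtain i where i: "i < k" "A = N - fs ! i" using A by blast
      have "finite (fs ! k)" using finite_subset[OF sub \<open>finite N\<close>] Suc.prems by simp
      then obtain j w where j: "j < k" "w \<notin> fs ! i" "fs ! k - fs ! j = {w}"
        using shelling_step_linear_quotient[OF _ i(1) fs(3)[of k]] i(1) Suc.prems by auto
      have "(N - fs ! j) - (N - fs ! k) = {w}" using j(3) sub[of k] Suc.prems by auto
      then show ?thesis using i(2) j(1,2) by blast
    qed
    ultimately show ?case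
      using Suc by (simp add: lessThan_Suc linear_quotients.insert)
  qed (simp add: linear_quotients.empty)
  from this[of "length fs"] have "linear_quotients ((\<lambda>i. N - fs ! i) ` {..<length fs})" by simp
  moreover have "(\<lambda>i. N - fs ! i) ` {..<length fs} = (\<lambda>F. N - F) ` set fs"
    by (auto simp: set_conv_nth)
  ultimately show ?thesis by (simp add: fs(2))
qed

section \<open>Diagonal arrangements of shellable complexes\<close>

text \<open>The labelling \<open>c\<close> encodes the set partition into its fibres; \<open>S\<close> is a set of labels, whose
  fibres are merged into one block.\<close>
definition glued :: "nat \<Rightarrow> (nat \<Rightarrow> 'a) \<Rightarrow> 'a set \<Rightarrow> (nat \<Rightarrow> real) set" where
  "glued n c S = {u\<in>Rn n. \<forall>i\<in>{1..n}. \<forall>j\<in>{1..n}. c i = c j \<or> c i \<in> S \<and> c j \<in> S \<longrightarrow> u i = u j}"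

definition fibre_indicator :: "nat \<Rightarrow> (nat \<Rightarrow> 'a) \<Rightarrow> 'a \<Rightarrow> nat \<Rightarrow> real" where
  "fibre_indicator n c p i = (if i \<in> {1..n} \<and> c i = p then 1 else 0)"

lemma glued_antimono: "A \<subseteq> B \<Longrightarrow> glued n c B \<subseteq> glued n c A"
  unfolding glued_def by blast

lemma Rn_eq_glued: "Rn n = glued n id {}"
  by (auto simp: glued_def)

lemma glued_image:
  assumes "G \<subseteq> {1..n}"
  shows "glued n c (c ` G) = glued n c {} \<inter> diag_subspace n G"
proof
  show "glued n c (c ` G) \<subseteq> glued n c {} \<inter> diag_subspace n G"
    using assms unfolding glued_def diag_subspace_def by blast
  show "glued n c {} \<inter> diag_subspace n G \<subseteq> glued n c (c ` G)"
  proof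
    fix u assume u: "u \<in> glued n c {} \<inter> diag_subspace n G"
    have fibre: "u i = u j" if "i \<in> {1..n}" "j \<in> {1..n}" "c i = c j" for i j
      using u that unfolding glued_def by blast
    have "u i = u j" if ij: "i \<in> {1..n}" "j \<in> {1..n}" "c i \<in> c ` G" "c j \<in> c ` G" for i j
    proof -
      obtain i' j' where "i' \<in> G" "c i = c i'" "j' \<in> G" "c j = c j'" using ij(3,4) by blast
      then have "u i = u i'" "u j = u j'" "u i' = u j'"
        using fibre ij(1,2) assms u unfolding diag_subspace_def by blast+
      then show ?thesis by simp
    qed
    then show "u \<in> glued n c (c ` G)" using u fibre unfolding glued_def by blast
  qed
qed

lemma diag_subspace_eq_glued: "G \<subseteq> {1..n} \<Longrightarrow> diag_subspace n G = glued n id G"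
  using glued_image[of G n id] Rn_eq_glued[of n] by (auto simp: diag_subspace_def)

lemma glued_subset_diag_subspace:
  assumes "G \<subseteq> {1..n}" "\<not> 2 \<le> card (c ` G)"
  shows "glued n c {} \<subseteq> diag_subspace n G"
proof -
  have "finite (c ` G)" using finite_subset[OF assms(1)] by simp
  moreover have "card (c ` G) \<le> Suc 0" using assms(2) by simp
  ultimately have "\<forall>p\<in>c ` G. \<forall>q\<in>c ` G. p = q" using card_le_Suc0_iff_eq by blast
  then have "c i = c j" if "i \<in> G" "j \<in> G" for i j using that by blast
  then show ?thesis using assms(1) unfolding glued_def diag_subspace_def by blast
qed

lemma glued_contract: "v \<in> S \<Longrightarrow> glued n (contract S v \<circ> c) {} = glued n c S"
  by (simp add: glued_def contract_eq_iff)

lemma glued_contract_image: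
  assumes "v \<in> S" "G \<subseteq> {1..n}"
  shows "glued n (contract S v \<circ> c) (contract S v ` c ` G) = glued n c S \<inter> glued n c (c ` G)"
  using glued_image[OF assms(2), of "contract S v \<circ> c"] glued_image[OF assms(2), of c]
    glued_contract[OF assms(1)] glued_antimono[of "{}" S n c]
  by (auto simp: image_comp)

lemma fibre_indicator_in_glued: "p \<notin> S \<Longrightarrow> fibre_indicator n c p \<in> glued n c S"
  by (auto simp: fibre_indicator_def glued_def Rn_def)

lemma fibre_indicator_in_diag_subspace:
  assumes "G \<subseteq> {1..n}" "p \<in> c ` G" "fibre_indicator n c p \<in> diag_subspace n G"
  shows "c ` G = {p}"
proof -
  obtain i where i: "i \<in> G" "c i = p" using assms(2) by blast
  have "c j = p" if "j \<in> G" for j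
  proof -
    have "fibre_indicator n c p j = fibre_indicator n c p i"
      using assms(3) i that unfolding diag_subspace_def by blast
    then show ?thesis using i assms(1) by (auto simp: fibre_indicator_def split: if_splits)
  qed
  then show ?thesis using assms(2) by auto
qed

lemma glued_subset_diag_subspaceD:
  assumes "glued n c A \<subseteq> diag_subspace n G" "G \<subseteq> {1..n}" "2 \<le> card (c ` G)"
  shows "c ` G \<subseteq> A"
proof
  fix p assume p: "p \<in> c ` G"
  show "p \<in> A"
  proof (rule ccontr)
    assume "p \<notin> A"
    then have "fibre_indicator n c p \<in> diag_subspace n G"
      using fibre_indicator_in_glued[of p A n c] assms(1) by blast
    then show False using fibre_indicator_in_diag_subspace[OF assms(2) p] assms(3) by simp
  qed
qed

lemma fibre_indicator_in_glued_iff: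
  assumes "S \<subseteq> c ` {1..n}" "2 \<le> card S"
  shows "fibre_indicator n c p \<in> glued n c S \<longleftrightarrow> p \<notin> S"
proof
  obtain G where G: "G \<subseteq> {1..n}" "S = c ` G" using assms(1) subset_imageE by blast
  assume "fibre_indicator n c p \<in> glued n c S"
  then have "fibre_indicator n c p \<in> diag_subspace n G"
    using glued_image[OF G(1), of c] G(2) by blast
  moreover have "S \<noteq> {p}" using assms(2) by auto
  ultimately show "p \<notin> S" using fibre_indicator_in_diag_subspace[OF G(1), of p c] G(2) by blast
qed (rule fibre_indicator_in_glued)

lemma inj_on_glued: "inj_on (glued n c) {S. S \<subseteq> c ` {1..n} \<and> 2 \<le> card S}"
proof (rule inj_onI, rule set_eqI)
  fix A B p assume "A \<in> {S. S \<subseteq> c ` {1..n} \<and> 2 \<le> card S}" "B \<in> {S. S \<subseteq> c ` {1..n} \<and> 2 \<le> card S}"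
    "glued n c A = glued n c B"
  then show "p \<in> A \<longleftrightarrow> p \<in> B" using fibre_indicator_in_glued_iff[of _ c n p] by auto
qed

lemma card_image_contract_less:
  assumes "finite N" "S \<subseteq> c ` N" "2 \<le> card S" "v \<in> S"
  shows "card ((contract S v \<circ> c) ` N) < card (c ` N)"
proof -
  have "\<not> S \<subseteq> {v}" using assms(3) card_mono[of "{v}" S] by auto
  then obtain w where "w \<in> S" "w \<noteq> v" by blast
  then have "\<not> inj_on (contract S v) (c ` N)"
    using assms(2,4) contract_eq_iff[of v S v w] inj_onD[of "contract S v" "c ` N" v w] by blast
  then have "card (contract S v ` c ` N) < card (c ` N)"
    using assms(1) by (meson card_image_le eq_card_imp_inj_on finite_imageI le_neq_implies_less)
  then show ?thesis by (simp add: image_comp)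
qed

locale diagonal_arrangement =
  fixes n :: nat and \<G> :: "nat set set"
  assumes \<G>_subset: "G \<in> \<G> \<Longrightarrow> G \<subseteq> {1..n}"
begin

abbreviation \<L> :: "(nat \<Rightarrow> real) set set" where
  "\<L> \<equiv> meets (Rn n) (diag_subspace n ` \<G>)"

definition minimal_image :: "(nat \<Rightarrow> nat) \<Rightarrow> nat set \<Rightarrow> bool" where
  "minimal_image c A \<longleftrightarrow> (\<exists>G\<in>\<G>. A = c ` G) \<and> 2 \<le> card A \<and>
     (\<forall>G\<in>\<G>. c ` G \<subseteq> A \<longrightarrow> 2 \<le> card (c ` G) \<longrightarrow> c ` G = A)"

lemma minimal_image_subset: "minimal_image c A \<Longrightarrow> A \<subseteq> c ` {1..n}"
  using \<G>_subset by (auto simp: minimal_image_def)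

lemma minimal_image_card: "minimal_image c A \<Longrightarrow> 2 \<le> card A"
  by (simp add: minimal_image_def)

lemma glued_image_in_lattice:
  assumes "glued n c {} \<in> \<L>" "G \<in> \<G>"
  shows "glued n c (c ` G) \<in> \<L>"
proof -
  have "diag_subspace n G \<in> \<L>"
    using assms(2) by (intro generator_in_meets) (auto simp: diag_subspace_def)
  then have "meets (glued n c {}) {diag_subspace n G} \<subseteq> \<L>"
    using assms(1) by (intro meets_subset_meets) auto
  then show ?thesis
    using bottom_in_meets[of "glued n c {}" "{diag_subspace n G}"]
      glued_image[OF \<G>_subset[OF assms(2)], of c] by auto
qed

lemma covers_glued:
  assumes base: "glued n c {} \<in> \<L>" and A: "minimal_image c A"
  shows "covers \<L> (glued n c {}) (glued n c A)"
proof -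
  obtain p where p: "p \<in> A" using minimal_image_card[OF A] by fastforce
  then have "glued n c A \<noteq> glued n c {}"
    using fibre_indicator_in_glued_iff[OF minimal_image_subset[OF A] minimal_image_card[OF A], of p]
      fibre_indicator_in_glued[of p "{}"] by blast
  then have less: "glued n c A < glued n c {}" using glued_antimono[of "{}" A n c] by auto
  have between: "z = glued n c A \<or> z = glued n c {}"
    if z: "z \<in> \<L>" "glued n c A \<subseteq> z" "z \<subseteq> glued n c {}" for z
  proof -
    obtain \<B> where \<B>: "\<B> \<subseteq> \<G>" "z = Rn n \<inter> \<Inter>(diag_subspace n ` \<B>)"
      using z(1) by (auto simp: meets_def subset_image_iff)
    have sub: "G \<subseteq> {1..n}" if "G \<in> \<B>" for G using \<G>_subset \<B>(1) that by blast
    show ?thesis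
    proof (cases "\<exists>G\<in>\<B>. 2 \<le> card (c ` G)")
      case True
      then obtain G where G: "G \<in> \<B>" "2 \<le> card (c ` G)" by blast
      have "glued n c A \<subseteq> diag_subspace n G" using z(2) \<B>(2) G(1) by blast
      then have "c ` G \<subseteq> A" using glued_subset_diag_subspaceD[OF _ sub[OF G(1)] G(2)] by blast
      then have "c ` G = A" using A G \<B>(1) unfolding minimal_image_def by blast
      then have "z \<subseteq> glued n c A" using glued_image[OF sub[OF G(1)], of c] z(3) \<B>(2) G(1) by blast
      then show ?thesis using z(2) by blast
    next
      case False
      then have "glued n c {} \<subseteq> diag_subspace n G" if "G \<in> \<B>" for G
        using glued_subset_diag_subspace[OF sub[OF that]] that by blast
      then have "glued n c {} \<subseteq> z" using \<B>(2) by (auto simp: glued_def)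
      then show ?thesis using z(3) by blast
    qed
  qed
  have "\<L> \<inter> {glued n c A<..<glued n c {}} = {}"
  proof (rule equals0I)
    fix z assume "z \<in> \<L> \<inter> {glued n c A<..<glued n c {}}"
    then show False using between[of z] by auto
  qed
  moreover have "glued n c A \<in> \<L>"
    using glued_image_in_lattice[OF base] A by (auto simp: minimal_image_def)
  ultimately show ?thesis using base less by (simp add: covers_def)
qed

lemma minimal_image_contraction:
  assumes "minimal_image c S" "v \<in> S" "\<And>A. A \<in> \<A> \<Longrightarrow> minimal_image c A" "B \<in> contraction S v \<A>"
  shows "minimal_image (contract S v \<circ> c) B"
proof -
  obtain A where "A \<in> \<A>" "B = contract S v ` A"
    using in_contraction_imp_image[OF assms(4,2)] assms(3) minimal_image_card by blast
  then have image: "\<exists>G\<in>\<G>. B = (contract S v \<circ> c) ` G"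
    using assms(3) by (metis image_comp minimal_image_def)
  show ?thesis
    using assms(4)
  proof (cases rule: contractionE)
    case disjoint
    have same: "(contract S v \<circ> c) ` G = c ` G" if "(contract S v \<circ> c) ` G \<subseteq> B" for G
    proof -
      have "c i \<notin> S" if "i \<in> G" for i
        using \<open>(contract S v \<circ> c) ` G \<subseteq> B\<close> that disjoint(2) assms(2) by (force simp: contract_def)
      then show ?thesis by (auto simp: contract_def)
    qed
    show ?thesis
      using assms(3)[OF disjoint(1)] image same unfolding minimal_image_def by metis
  next
    case (edge A w)
    then have "v \<noteq> w" using assms(2) by blast
    then have "card B = 2" using edge by simp
    moreover have "X = B" if "X \<subseteq> B" "2 \<le> card X" for X
      using that edge(3) \<open>card B = 2\<close> by (metis card_seteq finite.emptyI finite.insertI)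
    ultimately show ?thesis using image unfolding minimal_image_def by simp
  qed
qed

lemma shelled_insert_glued:
  assumes base: "glued n c {} \<in> \<L>"
    and minimal: "\<And>A. A \<in> insert S \<A> \<Longrightarrow> minimal_image c A" and "S \<notin> \<A>" "v \<in> S"
    and quotient: "\<And>A. A \<in> \<A> \<Longrightarrow> \<exists>B\<in>\<A>. \<exists>w\<in>A - S. B - S = {w}"
    and \<A>: "shelled \<L> (glued n c {}) (glued n c ` \<A>)"
    and contracted: "shelled \<L> (glued n c S) (glued n (contract S v \<circ> c) ` contraction S v \<A>)"
  shows "shelled \<L> (glued n c {}) (glued n c ` insert S \<A>)"
  unfolding image_insert
proof (rule shelled.insert[OF \<A> _ _ contracted])
  show "covers \<L> (glued n c {}) (glued n c S)" using covers_glued[OF base] minimal by blast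
  show "glued n c S \<notin> glued n c ` \<A>"
  proof
    assume "glued n c S \<in> glued n c ` \<A>"
    then obtain A where A: "A \<in> \<A>" "glued n c S = glued n c A" by blast
    then have "S = A"
      using minimal[THEN minimal_image_subset] minimal[THEN minimal_image_card]
      by (intro inj_onD[OF inj_on_glued[of n c] A(2)]) simp_all
    then show False using A(1) \<open>S \<notin> \<A>\<close> by simp
  qed
  have meet: "glued n (contract S v \<circ> c) (contract S v ` A) = glued n c S \<inter> glued n c A"
    if A: "A \<in> \<A>" for A
  proof -
    obtain G where "G \<in> \<G>" "A = c ` G" using minimal[of A] A by (auto simp: minimal_image_def)
    then show ?thesis using glued_contract_image[OF \<open>v \<in> S\<close> \<G>_subset] by simp
  qed
  show "glued n (contract S v \<circ> c) ` contraction S v \<A> \<subseteq>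
      meets (glued n c {}) (insert (glued n c S) (glued n c ` \<A>))"
  proof (rule image_subsetI)
    fix B assume "B \<in> contraction S v \<A>"
    then obtain A where A: "A \<in> \<A>" "B = contract S v ` A"
      using in_contraction_imp_image[OF _ \<open>v \<in> S\<close>] minimal minimal_image_card by blast
    then show "glued n (contract S v \<circ> c) B \<in>
        meets (glued n c {}) (insert (glued n c S) (glued n c ` \<A>))"
      using meet glued_antimono[of "{}" S n c]
      by (intro meetsI[of "{glued n c S, glued n c A}"]) auto
  qed
  fix a assume "a \<in> glued n c ` \<A>"
  then obtain A where A: "A \<in> \<A>" "a = glued n c A" by blast
  obtain B where "B \<in> contraction S v \<A>" "B \<subseteq> contract S v ` A"
    using contraction_subset_image[OF A(1) quotient[OF A(1)]] by blast
  then show "\<exists>x\<in>glued n (contract S v \<circ> c) ` contraction S v \<A>. inf (glued n c S) a \<le> x"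
    using meet[OF A(1)] A(2) glued_antimono[of B "contract S v ` A" n "contract S v \<circ> c"] by auto
qed

theorem shelled_glued:
  assumes "linear_quotients \<A>" "\<A> \<noteq> {}" "\<And>A. A \<in> \<A> \<Longrightarrow> minimal_image c A" "glued n c {} \<in> \<L>"
  shows "shelled \<L> (glued n c {}) (glued n c ` \<A>)"
  using assms
proof (induction "card (c ` {1..n})" arbitrary: c \<A> rule: less_induct)
  case less
  show ?case
    using less.prems
  proof (induction rule: linear_quotients.induct)
    case (insert \<A> S)
    have S: "minimal_image c S" using insert.prems by simp
    show ?case
    proof (cases "\<A> = {}")
      case True
      then show ?thesis using shelled.single[OF covers_glued[OF insert.prems(3) S]] by simp
    next
      case False
      obtain v where v: "v \<in> S" using minimal_image_card[OF S] by fastforce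
      have "shelled \<L> (glued n (contract S v \<circ> c) {})
          (glued n (contract S v \<circ> c) ` contraction S v \<A>)"
      proof (rule less.hyps)
        show "card ((contract S v \<circ> c) ` {1..n}) < card (c ` {1..n})"
          using minimal_image_subset[OF S] minimal_image_card[OF S] v
          by (intro card_image_contract_less) simp_all
        show "linear_quotients (contraction S v \<A>)"
          using linear_quotients_contraction[OF insert.hyps(1) v insert.hyps(3)] .
        obtain A where "A \<in> \<A>" using False by blast
        then show "contraction S v \<A> \<noteq> {}"
          using contraction_subset_image[OF _ insert.hyps(3)] by blast
        show "minimal_image (contract S v \<circ> c) B" if "B \<in> contraction S v \<A>" for B
          using minimal_image_contraction[OF S v _ that] insert.prems(2) by blast
        show "glued n (contract S v \<circ> c) {} \<in> \<L>"
          using glued_contract[OF v] glued_image_in_lattice[OF insert.prems(3)] S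
          by (auto simp: minimal_image_def)
      qed
      moreover have "shelled \<L> (glued n c {}) (glued n c ` \<A>)"
        using insert.IH insert.prems(2,3) False by blast
      ultimately show ?thesis
        using insert.prems(2,3) insert.hyps(2,3) v glued_contract[OF v]
        by (intro shelled_insert_glued) simp_all
    qed
  qed simp
qed

end

lemma finite_simplicial_complex: "simplicial_complex_on n \<Delta> \<Longrightarrow> finite \<Delta>"
  by (rule finite_subset[of _ "Pow {1..n}"]) (auto simp: simplicial_complex_on_def)

lemma facets_nonempty: "finite K \<Longrightarrow> K \<noteq> {} \<Longrightarrow> facets K \<noteq> {}"
  using finite_has_maximal[of K] by (fastforce simp: facets_def)

lemma intersection_lattice_eq_meets:
  "intersection_lattice n \<Delta> = meets (Rn n) (diag_arrangement n \<Delta>)"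
  by (simp add: intersection_lattice_def meets_def)

lemma minimal_image_facet_complement:
  assumes \<Delta>: "simplicial_complex_on n \<Delta>" and dim: "cx_dim_le \<Delta> (int n - 3)" and F: "F \<in> facets \<Delta>"
  shows "diagonal_arrangement.minimal_image ((\<lambda>F. {1..n} - F) ` facets \<Delta>) id ({1..n} - F)"
proof -
  interpret diagonal_arrangement n "(\<lambda>F. {1..n} - F) ` facets \<Delta>" by unfold_locales auto
  have F_sub: "F \<subseteq> {1..n}" using \<Delta> F by (simp add: simplicial_complex_on_def facets_def)
  have "int (card F) \<le> int n - 2" using dim F by (auto simp: cx_dim_le_def facets_def)
  moreover have "card ({1..n} - F) = n - card F"
    using F_sub by (simp add: card_Diff_subset finite_subset)
  ultimately have "2 \<le> card ({1..n} - F)" by linarith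
  moreover have "F' = F" if "F' \<in> facets \<Delta>" "{1..n} - F' \<subseteq> {1..n} - F" for F'
  proof -
    have "F \<subseteq> F'" using that(2) F_sub by blast
    then show ?thesis using F that(1) by (simp add: facets_def)
  qed
  ultimately show ?thesis using F unfolding minimal_image_def by auto
qed

theorem shelled_diag_arrangement:
  assumes \<Delta>: "simplicial_complex_on n \<Delta>" and "shellable \<Delta>" and dim: "cx_dim_le \<Delta> (int n - 3)"
  shows "shelled (intersection_lattice n \<Delta>) (Rn n) (diag_arrangement n \<Delta>)"
proof -
  define \<G> where "\<G> = (\<lambda>F. {1..n} - F) ` facets \<Delta>"
  interpret diagonal_arrangement n \<G> by unfold_locales (auto simp: \<G>_def)
  have "\<G> \<noteq> {}"
    using facets_nonempty[OF finite_simplicial_complex[OF \<Delta>]] \<Delta>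
    by (simp add: \<G>_def simplicial_complex_on_def)
  moreover have "minimal_image id A" if "A \<in> \<G>" for A
    using that minimal_image_facet_complement[OF \<Delta> dim] unfolding \<G>_def by blast
  moreover have "linear_quotients \<G>"
    using shellable_imp_linear_quotients[OF assms(2), of "{1..n}"] \<Delta>
    by (simp add: \<G>_def simplicial_complex_on_def)
  ultimately have "shelled \<L> (glued n id {}) (glued n id ` \<G>)"
    using base_in_meets by (intro shelled_glued) (auto simp flip: Rn_eq_glued)
  moreover have "glued n id ` \<G> = diag_subspace n ` \<G>"
    using diag_subspace_eq_glued \<G>_subset by (intro image_cong) auto
  moreover have "diag_arrangement n \<Delta> = diag_subspace n ` \<G>"
    by (simp add: diag_arrangement_def \<G>_def image_image)
  ultimately show ?thesis by (simp add: intersection_lattice_eq_meets flip: Rn_eq_glued)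
qed

section \<open>Realizations of simplicial complexes\<close>

abbreviation support :: "('a \<Rightarrow> real) \<Rightarrow> 'a set" where
  "support x \<equiv> {v. x v \<noteq> 0}"

definition subset_closed :: "'a set set \<Rightarrow> bool" where
  "subset_closed K \<longleftrightarrow> (\<forall>F\<in>K. Pow F \<subseteq> K)"

definition realization :: "'a set set \<Rightarrow> ('a \<Rightarrow> real) set" where
  "realization K = {x. (\<forall>v. 0 \<le> x v) \<and> sum x (support x) = 1 \<and> support x \<in> K}"

lemma subset_closedD: "subset_closed K \<Longrightarrow> F \<in> K \<Longrightarrow> G \<subseteq> F \<Longrightarrow> G \<in> K"
  by (auto simp: subset_closed_def)

lemma subset_closed_Un: "subset_closed K \<Longrightarrow> subset_closed L \<Longrightarrow> subset_closed (K \<union> L)"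
  by (auto simp: subset_closed_def)

lemma subset_closed_cone:
  assumes "subset_closed J"
  shows "subset_closed (J \<union> insert x ` J)"
  unfolding subset_closed_def
proof (intro ballI subsetI)
  fix F G assume "F \<in> J \<union> insert x ` J" "G \<in> Pow F"
  then obtain F' where F': "F' \<in> J" "G \<subseteq> insert x F'" by auto
  then have "G - {x} \<subseteq> F'" by blast
  then have "G - {x} \<in> J" by (rule subset_closedD[OF assms F'(1)])
  moreover have "G = G - {x} \<or> G = insert x (G - {x})" by blast
  ultimately show "G \<in> J \<union> insert x ` J" by (metis UnI1 UnI2 imageI)
qed

lemma finite_face: "finite K \<Longrightarrow> subset_closed K \<Longrightarrow> F \<in> K \<Longrightarrow> finite F"
  unfolding subset_closed_def by (meson finite_Pow_iff finite_subset)

lemma realization_mono: "K \<subseteq> L \<Longrightarrow> realization K \<subseteq> realization L"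
  by (auto simp: realization_def)

lemma realization_Un: "realization (K \<union> L) = realization K \<union> realization L"
  by (auto simp: realization_def)

lemma realization_Pow_iff:
  assumes "finite C"
  shows "x \<in> realization (Pow C) \<longleftrightarrow> (\<forall>v. 0 \<le> x v) \<and> (\<forall>v. v \<notin> C \<longrightarrow> x v = 0) \<and> sum x C = 1"
proof -
  have "sum x (support x) = sum x C" if "\<forall>v. v \<notin> C \<longrightarrow> x v = 0"
    using that assms by (intro sum.mono_neutral_left) auto
  moreover have "support x \<in> Pow C \<longleftrightarrow> (\<forall>v. v \<notin> C \<longrightarrow> x v = 0)" by auto
  ultimately show ?thesis unfolding realization_def mem_Collect_eq by metis
qed

lemma finite_support: "x \<in> realization K \<Longrightarrow> finite (support x)"
  by (rule ccontr) (simp add: realization_def)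

lemma support_nonempty: "x \<in> realization K \<Longrightarrow> support x \<noteq> {}"
  by (force simp: realization_def)

lemma simplex_nonempty: "x \<in> realization (Pow C) \<Longrightarrow> C \<noteq> {}"
  using support_nonempty[of x "Pow C"] by (auto simp: realization_def)

lemma geom_realization_eq_realization:
  assumes "finite V" "\<Union>K \<subseteq> V"
  shows "geom_realization V K = realization K"
proof -
  have "sum x V = sum x (support x)" if "support x \<in> K" for x
    using that assms by (intro sum.mono_neutral_right) auto
  moreover have "\<forall>v. v \<notin> V \<longrightarrow> x v = 0" if "support x \<in> K" for x using that assms(2) by blast
  ultimately show ?thesis
    unfolding geom_realization_def realization_def by (intro Collect_cong) metis
qed

lemma realization_eq_UN_simplices:
  assumes "subset_closed K"
  shows "realization K = (\<Union>C\<in>K. realization (Pow C))"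
  using subset_closedD[OF assms] by (auto simp: realization_def)

lemma continuous_on_coord: "continuous_on S (\<lambda>x. x v)"
  by (rule continuous_on_product_then_coordinatewise[OF continuous_on_id])

lemma Hausdorff_space_fun: "Hausdorff_space (top_of_set (S :: ('a \<Rightarrow> 'b::metric_space) set))"
proof -
  have "Hausdorff_space (euclidean :: ('a \<Rightarrow> 'b) topology)"
    by (simp add: Hausdorff_space_product_topology flip: euclidean_product_topology)
  then show ?thesis by (rule Hausdorff_space_subtopology)
qed

lemma compact_imp_closed_fun: "compact S \<Longrightarrow> closed (S :: ('a \<Rightarrow> 'b::metric_space) set)"
  using compactin_imp_closedin[OF Hausdorff_space_fun[of UNIV], of S] by simp

lemma compact_realization_Pow:
  assumes "finite C"
  shows "compact (realization (Pow C))"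
proof -
  have as_Int: "realization (Pow C) = {x. \<forall>v. 0 \<le> x v} \<inter> {x. \<forall>v. v \<notin> C \<longrightarrow> x v = 0} \<inter> {x. sum x C = 1}"
    using realization_Pow_iff[OF assms] by blast
  have "closed (realization (Pow C))"
    unfolding as_Int
    by (intro closed_Int closed_Collect_all closed_Collect_imp closed_Collect_le closed_Collect_eq
        open_Collect_const continuous_on_sum continuous_on_const continuous_on_product_coordinates)
  moreover have "compact (Pi\<^sub>E UNIV (\<lambda>_::'a. {0..1::real}))"
    using compactin_PiE[of "\<lambda>_. euclideanreal" UNIV "\<lambda>_::'a. {0..1::real}"]
    by (simp add: euclidean_product_topology)
  moreover have "realization (Pow C) \<subseteq> Pi\<^sub>E UNIV (\<lambda>_. {0..1})"
  proof
    fix x assume x: "x \<in> realization (Pow C)"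
    have "x v \<le> 1" for v
    proof (cases "v \<in> C")
      case True
      then have "x v \<le> sum x C"
        using x realization_Pow_iff[OF assms] assms by (intro member_le_sum) auto
      then show ?thesis using x realization_Pow_iff[OF assms, of x] by simp
    next
      case False
      then show ?thesis using x realization_Pow_iff[OF assms, of x] by simp
    qed
    then show "x \<in> Pi\<^sub>E UNIV (\<lambda>_. {0..1})" using x by (auto simp: realization_def)
  qed
  ultimately show ?thesis by (metis compact_Int_closed inf.absorb_iff2)
qed

lemma compact_realization:
  assumes "finite K" "subset_closed K"
  shows "compact (realization K)"
  unfolding realization_eq_UN_simplices[OF assms(2)]
  using assms(1) finite_face[OF assms] by (simp add: compact_UN compact_realization_Pow)

lemma closed_realization: "finite K \<Longrightarrow> subset_closed K \<Longrightarrow> closed (realization K)"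
  by (intro compact_imp_closed_fun compact_realization)

section \<open>Homotopy extension\<close>

definition homotopy_from ::
  "'a::topological_space set \<Rightarrow> 'b::topological_space set \<Rightarrow> ('a \<Rightarrow> 'b) \<Rightarrow> (real \<times> 'a \<Rightarrow> 'b) \<Rightarrow> bool" where
  "homotopy_from X T f h \<longleftrightarrow>
     continuous_on ({0..1} \<times> X) h \<and> h \<in> {0..1} \<times> X \<rightarrow> T \<and> (\<forall>x\<in>X. h (0, x) = f x)"

lemma homotopy_fromI:
  assumes "continuous_on ({0..1} \<times> X) h"
    and "\<And>t x. t \<in> {0..1} \<Longrightarrow> x \<in> X \<Longrightarrow> h (t, x) \<in> T" "\<And>x. x \<in> X \<Longrightarrow> h (0, x) = f x"
  shows "homotopy_from X T f h"
  using assms by (auto simp: homotopy_from_def)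

lemma homotopy_fromD:
  assumes "homotopy_from X T f h"
  shows "continuous_on ({0..1} \<times> X) h" "\<And>t x. t \<in> {0..1} \<Longrightarrow> x \<in> X \<Longrightarrow> h (t, x) \<in> T"
    "\<And>x. x \<in> X \<Longrightarrow> h (0, x) = f x"
  using assms by (auto simp: homotopy_from_def)

lemma homotopy_from_subset: "homotopy_from X T f h \<Longrightarrow> Y \<subseteq> X \<Longrightarrow> homotopy_from Y T f h"
  unfolding homotopy_from_def by (auto intro: continuous_on_subset[OF _ Sigma_mono])

definition min_coord :: "'a set \<Rightarrow> ('a \<Rightarrow> real) \<Rightarrow> real" where
  "min_coord C x = Min (x ` C)"

lemma min_coord_le: "finite C \<Longrightarrow> v \<in> C \<Longrightarrow> min_coord C x \<le> x v"
  by (simp add: min_coord_def)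

lemma min_coord_attained:
  assumes "finite C" "C \<noteq> {}"
  obtains v where "v \<in> C" "min_coord C x = x v"
proof -
  have "min_coord C x \<in> x ` C" unfolding min_coord_def using assms by (intro Min_in) auto
  then show ?thesis using that by blast
qed

lemma continuous_on_min_coord:
  assumes "finite C" "continuous_on S f"
  shows "continuous_on S (\<lambda>p. min_coord C (f p))"
  using assms(1)
proof (induction C)
  case (insert v C)
  have coord: "continuous_on S (\<lambda>p. f p v)"
    by (rule continuous_on_product_then_coordinatewise[OF assms(2)])
  show ?case
  proof (cases "C = {}")
    case False
    then have "min_coord (insert v C) (f p) = min (f p v) (min_coord C (f p))" for p
      using insert.hyps by (simp add: min_coord_def)
    then show ?thesis using coord insert.IH by (simp add: continuous_on_min)
  qed (simp add: min_coord_def coord)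
qed (simp add: min_coord_def)

lemma min_coord_nonneg:
  assumes "finite C" "x \<in> realization (Pow C)"
  shows "0 \<le> min_coord C x"
proof -
  obtain v where "min_coord C x = x v"
    using min_coord_attained[OF assms(1) simplex_nonempty[OF assms(2)]] .
  then show ?thesis using assms(2) by (simp add: realization_def)
qed

lemma min_coord_eq_0_iff:
  assumes "finite C" "x \<in> realization (Pow C)"
  shows "min_coord C x = 0 \<longleftrightarrow> support x \<noteq> C"
proof -
  obtain v where v: "v \<in> C" "min_coord C x = x v"
    using min_coord_attained[OF assms(1) simplex_nonempty[OF assms(2)]] .
  show ?thesis
  proof
    assume "support x \<noteq> C"
    then obtain u where "u \<in> C" "x u = 0" using assms(2) by (auto simp: realization_def)
    then show "min_coord C x = 0"
      using min_coord_le[OF assms(1), of u x] min_coord_nonneg[OF assms] by simp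
  qed (use v in auto)
qed

text \<open>Moves \<open>x\<close> away from the barycentre of the simplex \<open>C\<close>, all the way to the boundary if
  \<open>s = min_coord C x\<close>.\<close>
definition shave :: "'a set \<Rightarrow> real \<Rightarrow> ('a \<Rightarrow> real) \<Rightarrow> 'a \<Rightarrow> real" where
  "shave C s x v = (if v \<in> C then (x v - s) / (1 - real (card C) * s) else 0)"

lemma shave_0: "finite C \<Longrightarrow> x \<in> realization (Pow C) \<Longrightarrow> shave C 0 x = x"
  by (auto simp: shave_def realization_Pow_iff)

lemma shave_in_simplex:
  assumes "finite C" "x \<in> realization (Pow C)" "s \<le> min_coord C x" "real (card C) * s < 1"
  shows "shave C s x \<in> realization (Pow C)"
proof -
  have "0 \<le> shave C s x v" for v
    using assms(3,4) min_coord_le[OF assms(1), of v x] by (auto simp: shave_def)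
  moreover have "sum (shave C s x) C = 1"
  proof -
    have "sum (shave C s x) C = (\<Sum>v\<in>C. x v - s) / (1 - real (card C) * s)"
      by (simp add: shave_def sum_divide_distrib)
    also have "(\<Sum>v\<in>C. x v - s) = 1 - real (card C) * s"
      using assms(2) realization_Pow_iff[OF assms(1), of x] by (simp add: sum_subtractf)
    finally show ?thesis using assms(4) by simp
  qed
  ultimately show ?thesis unfolding realization_Pow_iff[OF assms(1)] by (simp add: shave_def)
qed

lemma shave_min_coord:
  assumes "finite C" "x \<in> realization (Pow C)" "real (card C) * min_coord C x < 1"
  shows "shave C (min_coord C x) x \<in> realization (Pow C - {C})"
proof -
  obtain v where v: "v \<in> C" "min_coord C x = x v"
    using min_coord_attained[OF assms(1) simplex_nonempty[OF assms(2)]] .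
  then have "shave C (min_coord C x) x v = 0" by (simp add: shave_def)
  then have "support (shave C (min_coord C x) x) \<noteq> C" using v(1) by blast
  then show ?thesis
    using shave_in_simplex[OF assms(1,2) order_refl assms(3)] by (simp add: realization_def)
qed

lemma continuous_on_shave:
  assumes "continuous_on S s" "continuous_on S f" "\<And>p. p \<in> S \<Longrightarrow> real (card C) * s p < 1"
  shows "continuous_on S (\<lambda>p. shave C (s p) (f p))"
proof (rule continuous_on_coordinatewise_then_product)
  fix v
  have "continuous_on S (\<lambda>p. f p v)"
    by (rule continuous_on_product_then_coordinatewise[OF assms(2)])
  then show "continuous_on S (\<lambda>p. shave C (s p) (f p) v)"
    unfolding shave_def using assms(3)
    by (cases "v \<in> C") (auto intro!: continuous_intros assms(1) simp: less_imp_neq)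
qed

text \<open>Retracts the prism \<open>{0..1} \<times> C\<close> onto its bottom and sides: \<open>x\<close> is moved away from the barycentre
  until, at time \<open>2 * card C * min_coord C x\<close>, it reaches the boundary; the rest of the time is kept.
  The factor \<open>2\<close> keeps the denominator of \<open>shave\<close> positive.\<close>
definition prism_retraction :: "'a set \<Rightarrow> real \<times> ('a \<Rightarrow> real) \<Rightarrow> real \<times> ('a \<Rightarrow> real)" where
  "prism_retraction C p =
     (max 0 (fst p - 2 * real (card C) * min_coord C (snd p)),
      shave C (min (fst p / (2 * real (card C))) (min_coord C (snd p))) (snd p))"

lemma continuous_on_prism_retraction:
  assumes "finite C"
  shows "continuous_on ({0..1} \<times> realization (Pow C)) (prism_retraction C)"
  unfolding prism_retraction_def
proof (rule continuous_on_Pair)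
  let ?D = "{0..1::real} \<times> realization (Pow C)" and ?k = "real (card C)"
  have snd: "continuous_on ?D snd" by (intro continuous_on_snd continuous_on_id)
  have min_coord: "continuous_on ?D (\<lambda>p. min_coord C (snd p))"
    by (rule continuous_on_min_coord[OF assms snd])
  show "continuous_on ?D (\<lambda>p. max 0 (fst p - 2 * ?k * min_coord C (snd p)))"
    by (intro continuous_intros min_coord)
  show "continuous_on ?D (\<lambda>p. shave C (min (fst p / (2 * ?k)) (min_coord C (snd p))) (snd p))"
  proof (rule continuous_on_shave[OF _ snd])
    show "continuous_on ?D (\<lambda>p. min (fst p / (2 * ?k)) (min_coord C (snd p)))"
      unfolding divide_inverse by (intro continuous_intros min_coord)
    fix p assume "p \<in> ?D"
    have "?k * min (fst p / (2 * ?k)) (min_coord C (snd p)) \<le> ?k * (fst p / (2 * ?k))"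
      by (intro mult_left_mono) auto
    also have "\<dots> < 1" using \<open>p \<in> ?D\<close> by auto
    finally show "?k * min (fst p / (2 * ?k)) (min_coord C (snd p)) < 1" .
  qed
qed

lemma prism_retraction_in_bottom_Un_sides:
  assumes C: "finite C" and t: "t \<in> {0..1}" and x: "x \<in> realization (Pow C)"
  shows "prism_retraction C (t, x) \<in>
    {0} \<times> realization (Pow C) \<union> {0..1} \<times> realization (Pow C - {C})"
proof -
  let ?k = "real (card C)" and ?m = "min_coord C x"
  have k: "0 < ?k" using C simplex_nonempty[OF x] by (simp add: card_gt_0_iff)
  show ?thesis
  proof (cases "t \<le> 2 * ?k * ?m")
    case True
    then have "t / (2 * ?k) \<le> ?m" using k by (simp add: field_simps)
    then have "shave C (t / (2 * ?k)) x \<in> realization (Pow C)"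
      using k t by (intro shave_in_simplex[OF C x]) auto
    then show ?thesis using True \<open>t / (2 * ?k) \<le> ?m\<close> by (simp add: prism_retraction_def)
  next
    case False
    then have "?m \<le> t / (2 * ?k)" using k by (simp add: field_simps)
    moreover have "?k * ?m < 1" using False t by auto
    moreover have "0 \<le> ?k * ?m" using min_coord_nonneg[OF C x] by simp
    ultimately show ?thesis
      using False t shave_min_coord[OF C x] by (simp add: prism_retraction_def)
  qed
qed

lemma prism_retraction_id:
  assumes C: "finite C" and t: "t \<in> {0..1}" and x: "x \<in> realization (Pow C)"
    and "t = 0 \<or> x \<in> realization (Pow C - {C})"
  shows "prism_retraction C (t, x) = (t, x)"
proof -
  have "0 \<le> real (card C) * min_coord C x" using min_coord_nonneg[OF C x] by simp
  moreover have "t = 0 \<or> min_coord C x = 0"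
    using assms(4) min_coord_eq_0_iff[OF C x] by (auto simp: realization_def)
  ultimately have "max 0 (t - 2 * real (card C) * min_coord C x) = t"
    "min (t / (2 * real (card C))) (min_coord C x) = 0"
    using t min_coord_nonneg[OF C x] by auto
  then show ?thesis using shave_0[OF C x] by (simp add: prism_retraction_def)
qed

lemma homotopy_extension_simplex_boundary:
  assumes C: "finite C"
    and f: "continuous_on (realization (Pow C)) f" "f \<in> realization (Pow C) \<rightarrow> T"
    and h: "homotopy_from (realization (Pow C - {C})) T f h"
  obtains g where "homotopy_from (realization (Pow C)) T f g"
    "\<And>t x. t \<in> {0..1} \<Longrightarrow> x \<in> realization (Pow C - {C}) \<Longrightarrow> g (t, x) = h (t, x)"
proof -
  let ?S = "realization (Pow C)" and ?B = "realization (Pow C - {C})"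
  let ?r = "prism_retraction C"
  define H where "H p = (if fst p = 0 then f (snd p) else h p)" for p
  have "?B \<subseteq> ?S" by (intro realization_mono) auto
  have H_sides: "H (t, x) = h (t, x)" if "x \<in> ?B" for t x
    using homotopy_fromD(3)[OF h that] by (simp add: H_def)
  have H_in: "H p \<in> T" if p: "p \<in> {0} \<times> ?S \<union> {0..1} \<times> ?B" for p
  proof (cases "fst p = 0")
    case True
    then have "snd p \<in> ?S" using p \<open>?B \<subseteq> ?S\<close> by auto
    then show ?thesis using f(2) True by (auto simp: H_def)
  next
    case False
    then have "fst p \<in> {0..1}" "snd p \<in> ?B" using p by auto
    then show ?thesis using homotopy_fromD(2)[OF h, of "fst p" "snd p"] False by (simp add: H_def)
  qed
  have "continuous_on ({0} \<times> ?S \<union> {0..1} \<times> ?B) H"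
  proof (rule continuous_on_closed_Un)
    have "subset_closed (Pow C - {C})" by (auto simp: subset_closed_def)
    then show "closed ({0..1::real} \<times> ?B)" using C by (intro closed_Times closed_realization) auto
    show "closed ({0::real} \<times> ?S)"
      using compact_imp_closed_fun[OF compact_realization_Pow[OF C]] by (intro closed_Times) auto
    have "continuous_on ({0} \<times> ?S) (\<lambda>p. f (snd p))"
      by (rule continuous_on_compose2[OF f(1) continuous_on_snd[OF continuous_on_id]]) auto
    then show "continuous_on ({0} \<times> ?S) H" by (rule continuous_on_eq) (auto simp: H_def)
    show "continuous_on ({0..1} \<times> ?B) H"
      using homotopy_fromD(1)[OF h] by (rule continuous_on_eq) (auto simp: H_sides)
  qed
  then have "continuous_on ({0..1} \<times> ?S) (\<lambda>p. H (?r p))"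
    by (rule continuous_on_compose2[OF _ continuous_on_prism_retraction[OF C]])
      (use prism_retraction_in_bottom_Un_sides[OF C] in blast)
  then have "homotopy_from ?S T f (\<lambda>p. H (?r p))"
  proof (rule homotopy_fromI)
    show "H (?r (t, x)) \<in> T" if "t \<in> {0..1}" "x \<in> ?S" for t x
      by (rule H_in[OF prism_retraction_in_bottom_Un_sides[OF C that]])
    show "H (?r (0, x)) = f x" if "x \<in> ?S" for x
      using prism_retraction_id[OF C _ that] by (simp add: H_def)
  qed
  moreover have "H (?r (t, x)) = h (t, x)" if "t \<in> {0..1}" "x \<in> ?B" for t x
    using prism_retraction_id[OF C that(1), of x] that(2) \<open>?B \<subseteq> ?S\<close> H_sides by auto
  ultimately show ?thesis by (rule that)
qed

lemma homotopy_extension_insert: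
  assumes K: "finite K" "subset_closed K" and C: "finite C" "C \<notin> K" "Pow C - {C} \<subseteq> K"
    and f: "continuous_on (realization (insert C K)) f" "f \<in> realization (insert C K) \<rightarrow> T"
    and h: "homotopy_from (realization K) T f h"
  obtains G where "homotopy_from (realization (insert C K)) T f G"
    "\<And>t x. t \<in> {0..1} \<Longrightarrow> x \<in> realization K \<Longrightarrow> G (t, x) = h (t, x)"
proof -
  have "insert C K = K \<union> Pow C" using C(3) by auto
  then have insert: "realization (insert C K) = realization K \<union> realization (Pow C)"
    by (simp add: realization_Un)
  have "homotopy_from (realization (Pow C - {C})) T f h"
    by (rule homotopy_from_subset[OF h realization_mono[OF C(3)]])
  moreover have "continuous_on (realization (Pow C)) f" "f \<in> realization (Pow C) \<rightarrow> T"
    using f continuous_on_subset insert by auto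
  ultimately obtain g where g: "homotopy_from (realization (Pow C)) T f g"
    "\<And>t x. t \<in> {0..1} \<Longrightarrow> x \<in> realization (Pow C - {C}) \<Longrightarrow> g (t, x) = h (t, x)"
    using homotopy_extension_simplex_boundary[OF C(1)] by metis
  have overlap: "x \<in> realization (Pow C - {C})" if "x \<in> realization K" "x \<in> realization (Pow C)" for x
    using that C(2) by (auto simp: realization_def)
  define G where "G p = (if snd p \<in> realization K then h p else g p)" for p
  have "continuous_on ({0..1} \<times> realization K \<union> {0..1} \<times> realization (Pow C)) G"
    unfolding G_def
  proof (rule continuous_on_cases[OF _ _ homotopy_fromD(1)[OF h] homotopy_fromD(1)[OF g(1)]])
    show "closed ({0..1::real} \<times> realization K)" "closed ({0..1::real} \<times> realization (Pow C))"
      using closed_realization[OF K] compact_imp_closed_fun[OF compact_realization_Pow[OF C(1)]]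
      by (simp_all add: closed_Times)
    show "\<forall>p. p \<in> {0..1} \<times> realization K \<and> snd p \<notin> realization K \<or>
        p \<in> {0..1} \<times> realization (Pow C) \<and> snd p \<in> realization K \<longrightarrow> h p = g p"
      using g(2) overlap by auto
  qed
  then have "homotopy_from (realization (insert C K)) T f G"
    using homotopy_fromD(2,3)[OF h] homotopy_fromD(2,3)[OF g(1)]
    by (intro homotopy_fromI) (auto simp: insert Sigma_Un_distrib2 G_def)
  then show ?thesis by (rule that) (simp add: G_def)
qed

theorem homotopy_extension:
  assumes K: "finite K" "subset_closed K" and L: "subset_closed L" "L \<subseteq> K"
    and f: "continuous_on (realization K) f" "f \<in> realization K \<rightarrow> T"
    and h: "homotopy_from (realization L) T f h"
  shows "\<exists>G. homotopy_from (realization K) T f G \<and>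
    (\<forall>t\<in>{0..1}. \<forall>x\<in>realization L. G (t, x) = h (t, x))"
  using L h
proof (induction "card (K - L)" arbitrary: L h rule: less_induct)
  case less
  show ?case
  proof (cases "L = K")
    case True
    then show ?thesis using less.prems by blast
  next
    case False
    then have "finite (K - L)" "K - L \<noteq> {}" using K(1) less.prems(2) by auto
    then obtain C where C: "C \<in> K - L" and minimal: "\<And>D. D \<in> K - L \<Longrightarrow> D \<subseteq> C \<Longrightarrow> C = D"
      using finite_has_minimal[of "K - L"] by metis
    have faces: "Pow C - {C} \<subseteq> L" using minimal subset_closedD[OF K(2), of C] C by blast
    have sub: "insert C L \<subseteq> K" using C less.prems(2) by blast
    then have "continuous_on (realization (insert C L)) f" "f \<in> realization (insert C L) \<rightarrow> T"
      using f realization_mono[OF sub] by (auto intro: continuous_on_subset)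
    moreover have "finite L" using K(1) less.prems(2) finite_subset by blast
    moreover have "finite C" "C \<notin> L" using finite_face[OF K, of C] C by blast+
    ultimately obtain G where G: "homotopy_from (realization (insert C L)) T f G"
      "\<And>t x. t \<in> {0..1} \<Longrightarrow> x \<in> realization L \<Longrightarrow> G (t, x) = h (t, x)"
      using homotopy_extension_insert[OF _ less.prems(1) _ _ faces _ _ less.prems(3)] by metis
    have "card (K - insert C L) < card (K - L)" using C K(1) by (intro psubset_card_mono) auto
    moreover have "subset_closed (insert C L)"
      using faces less.prems(1) by (auto simp: subset_closed_def)
    ultimately obtain G' where "homotopy_from (realization K) T f G'"
      "\<forall>t\<in>{0..1}. \<forall>x\<in>realization (insert C L). G' (t, x) = G (t, x)"
      using less.hyps[OF _ _ sub G(1)] by blast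
    moreover have "realization L \<subseteq> realization (insert C L)" by (intro realization_mono) auto
    ultimately show ?thesis using G(2) by (intro exI[of _ G']) auto
  qed
qed

section \<open>Collapsing contractible subcomplexes\<close>

lemma homotopy_from_imp_homotopic:
  assumes "homotopy_from S T f h" "\<And>x. x \<in> S \<Longrightarrow> h (1, x) = g x"
  shows "homotopic_with_canon (\<lambda>_. True) S T f g"
  using assms by (auto simp: homotopic_with homotopy_from_def intro!: exI[of _ h])

lemma continuous_on_compact_image_factor:
  assumes "compact X" "continuous_on X \<phi>" "Hausdorff_space (top_of_set (\<phi> ` X))"
    and "continuous_on X (\<lambda>x. g (\<phi> x))"
  shows "continuous_on (\<phi> ` X) g"
proof -
  have "quotient_map (top_of_set X) (top_of_set (\<phi> ` X)) \<phi>"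
    using assms(1-3) by (intro continuous_imp_quotient_map) (auto simp: compact_space_subtopology)
  moreover have "continuous_map (top_of_set X) euclidean (g \<circ> \<phi>)"
    using assms(4) by (simp add: comp_def)
  ultimately have "continuous_map (top_of_set (\<phi> ` X)) euclidean g"
    by (rule continuous_compose_quotient_map)
  then show ?thesis by simp
qed

lemma continuous_on_homotopy_compact_image_factor:
  fixes X :: "'a::topological_space set" and \<phi> :: "'a \<Rightarrow> 'b::topological_space"
  assumes X: "compact X" and \<phi>: "continuous_on X \<phi>" "Hausdorff_space (top_of_set (\<phi> ` X))"
    and F: "continuous_on ({0..1::real} \<times> X) (\<lambda>p. F (fst p, \<phi> (snd p)))"
  shows "continuous_on ({0..1} \<times> \<phi> ` X) F"
proof -
  let ?\<Phi> = "\<lambda>p::real \<times> 'a. (fst p, \<phi> (snd p))"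
  have image: "?\<Phi> ` ({0..1} \<times> X) = {0..1} \<times> \<phi> ` X" by (auto simp: image_iff)
  have "continuous_on (?\<Phi> ` ({0..1} \<times> X)) F"
  proof (rule continuous_on_compact_image_factor)
    show "continuous_on ({0..1} \<times> X) ?\<Phi>"
      by (intro continuous_intros continuous_on_compose2[OF \<phi>(1)]) auto
    show "Hausdorff_space (top_of_set (?\<Phi> ` ({0..1} \<times> X)))"
      unfolding image using \<phi>(2) Hausdorff_space_subtopology[of euclideanreal "{0..1}"]
      by (simp add: Hausdorff_space_prod_topology flip: prod_topology_subtopology_eu)
  qed (intro compact_Times X compact_Icc, rule F)
  then show ?thesis by (simp only: image)
qed

lemma homotopy_equivalent_collapse:
  fixes X :: "'a::topological_space set" and \<phi> :: "'a \<Rightarrow> 'b::topological_space"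
  assumes X: "compact X" and \<phi>: "continuous_on X \<phi>" "Hausdorff_space (top_of_set (\<phi> ` X))"
    and A: "\<And>x y. x \<in> X \<Longrightarrow> y \<in> X \<Longrightarrow> \<phi> x = \<phi> y \<Longrightarrow> x = y \<or> x \<in> A \<and> y \<in> A"
      "\<And>x y. x \<in> A \<Longrightarrow> y \<in> A \<Longrightarrow> \<phi> x = \<phi> y"
    and G: "homotopy_from X X id G"
      "\<And>t x. t \<in> {0..1} \<Longrightarrow> x \<in> A \<Longrightarrow> G (t, x) \<in> A" "\<And>x. x \<in> A \<Longrightarrow> G (1, x) = a"
  shows "X homotopy_eqv \<phi> ` X"
proof -
  define \<sigma> where "\<sigma> = inv_into X \<phi>"
  define \<psi> where "\<psi> w = G (1, \<sigma> w)" for w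
  define F where "F p = \<phi> (G (fst p, \<sigma> (snd p)))" for p
  note G_cont = homotopy_fromD(1)[OF G(1)] and G_in = homotopy_fromD(2)[OF G(1)]
    and G_0 = homotopy_fromD(3)[OF G(1)]
  have \<sigma>: "\<sigma> w \<in> X" "\<phi> (\<sigma> w) = w" if "w \<in> \<phi> ` X" for w
    using that unfolding \<sigma>_def by (auto intro: inv_into_into f_inv_into_f)
  have \<sigma>\<phi>: "\<sigma> (\<phi> x) = x \<or> \<sigma> (\<phi> x) \<in> A \<and> x \<in> A" if "x \<in> X" for x
    using A(1)[of "\<sigma> (\<phi> x)" x] \<sigma>[of "\<phi> x"] that by blast
  have \<psi>\<phi>: "\<psi> (\<phi> x) = G (1, x)" if "x \<in> X" for x
    using \<sigma>\<phi>[OF that] G(3) by (auto simp: \<psi>_def)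
  have F\<phi>: "F (t, \<phi> x) = \<phi> (G (t, x))" if "t \<in> {0..1}" "x \<in> X" for t x
    using \<sigma>\<phi>[OF that(2)]
  proof
    assume "\<sigma> (\<phi> x) \<in> A \<and> x \<in> A"
    then have "G (t, \<sigma> (\<phi> x)) \<in> A" "G (t, x) \<in> A" using G(2)[OF that(1)] by blast+
    then show ?thesis unfolding F_def fst_conv snd_conv by (rule A(2))
  qed (simp add: F_def)
  have "continuous_on X (\<lambda>x. G (1, x))"
    by (rule continuous_on_compose2[OF G_cont]) (auto intro!: continuous_intros)
  then have "continuous_on X (\<lambda>x. \<psi> (\<phi> x))" using \<psi>\<phi> by (simp cong: continuous_on_cong)
  then have \<psi>: "continuous_on (\<phi> ` X) \<psi>" by (rule continuous_on_compact_image_factor[OF X \<phi>])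
  have "continuous_on ({0..1} \<times> X) (\<lambda>p. \<phi> (G p))"
    by (rule continuous_on_compose2[OF \<phi>(1) G_cont]) (use G_in in auto)
  then have "continuous_on ({0..1} \<times> X) (\<lambda>p. F (fst p, \<phi> (snd p)))"
    by (rule continuous_on_eq) (use F\<phi> in auto)
  then have F: "continuous_on ({0..1} \<times> \<phi> ` X) F"
    by (rule continuous_on_homotopy_compact_image_factor[OF X \<phi>])
  have "homotopy_from (\<phi> ` X) (\<phi> ` X) id F"
    using F F\<phi> G_in \<sigma> G_0 by (intro homotopy_fromI) (auto simp: F_def)
  then have "homotopic_with_canon (\<lambda>_. True) (\<phi> ` X) (\<phi> ` X) id (\<phi> \<circ> \<psi>)"
    by (rule homotopy_from_imp_homotopic) (simp add: F_def \<psi>_def)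
  moreover have "homotopic_with_canon (\<lambda>_. True) X X id (\<psi> \<circ> \<phi>)"
    using G(1) \<psi>\<phi> by (intro homotopy_from_imp_homotopic[of _ _ _ G]) auto
  moreover have "\<psi> \<in> \<phi> ` X \<rightarrow> X" using \<psi>\<phi> G_in by auto
  ultimately show ?thesis
    unfolding homotopy_equivalent_space_def using \<phi>(1) \<psi>
    by (intro exI[of _ \<phi>] exI[of _ \<psi>]) (auto dest: homotopic_with_symD)
qed

theorem homotopy_equivalent_collapse_subcomplex:
  fixes \<phi> :: "('a \<Rightarrow> real) \<Rightarrow> 'b \<Rightarrow> real"
  assumes K: "finite K" "subset_closed K" and L: "subset_closed L" "L \<subseteq> K"
    and contractible: "contractible (realization L)"
    and \<phi>: "continuous_on (realization K) \<phi>"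
      "\<And>x y. x \<in> realization K \<Longrightarrow> y \<in> realization K \<Longrightarrow> \<phi> x = \<phi> y \<Longrightarrow>
        x = y \<or> x \<in> realization L \<and> y \<in> realization L"
      "\<And>x y. x \<in> realization L \<Longrightarrow> y \<in> realization L \<Longrightarrow> \<phi> x = \<phi> y"
  shows "realization K homotopy_eqv \<phi> ` realization K"
proof -
  let ?K = "realization K" and ?L = "realization L"
  obtain a where "homotopic_with_canon (\<lambda>_. True) ?L ?L id (\<lambda>_. a)"
    using contractible unfolding contractible_def by blast
  then obtain h where h: "homotopy_from ?L ?L id h" "\<And>x. x \<in> ?L \<Longrightarrow> h (1, x) = a"
    by (auto simp: homotopic_with homotopy_from_def)
  have "homotopy_from ?L ?K id h"
    using homotopy_fromD[OF h(1)] realization_mono[OF L(2)] by (intro homotopy_fromI) auto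
  moreover have "continuous_on ?K id" "id \<in> ?K \<rightarrow> ?K" by (simp_all add: id_def)
  ultimately obtain G where G: "homotopy_from ?K ?K id G" "\<forall>t\<in>{0..1}. \<forall>x\<in>?L. G (t, x) = h (t, x)"
    using homotopy_extension[OF K L] by blast
  show ?thesis
  proof (rule homotopy_equivalent_collapse[OF compact_realization[OF K] \<phi>(1) Hausdorff_space_fun
        \<phi>(2,3) G(1)])
    show "G (t, x) \<in> ?L" if "t \<in> {0..1}" "x \<in> ?L" for t x
      using G(2) homotopy_fromD(2)[OF h(1)] that by simp
    show "G (1, x) = a" if "x \<in> ?L" for x using G(2) h(2) that by simp
  qed
qed

definition face_weight :: "'a set set \<Rightarrow> ('a \<Rightarrow> real) \<Rightarrow> real" where
  "face_weight \<F> x = (\<Sum>F\<in>\<F>. \<Prod>v\<in>F. x v)"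

text \<open>For \<open>\<F> = K - L\<close> the weight vanishes exactly on the realization of \<open>L\<close>, so that this is a model
  of the quotient by it; it depends on \<open>\<F>\<close> only, not on \<open>K\<close>.\<close>
definition collapse_map :: "'a set set \<Rightarrow> ('a \<Rightarrow> real) \<Rightarrow> 'a option \<Rightarrow> real" where
  "collapse_map \<F> x i = face_weight \<F> x * (case i of None \<Rightarrow> 1 | Some v \<Rightarrow> x v)"

lemma face_weight_eq_0_iff:
  assumes K: "finite K" "subset_closed K" and L: "subset_closed L" and x: "x \<in> realization K"
  shows "face_weight (K - L) x = 0 \<longleftrightarrow> x \<in> realization L"
proof -
  have "face_weight (K - L) x = 0 \<longleftrightarrow> (\<forall>F\<in>K - L. (\<Prod>v\<in>F. x v) = 0)"
    unfolding face_weight_def using K(1) x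
    by (intro sum_nonneg_eq_0_iff) (auto simp: realization_def intro: prod_nonneg)
  also have "\<dots> \<longleftrightarrow> (\<forall>F\<in>K - L. \<not> F \<subseteq> support x)"
    using finite_face[OF K] by (auto simp: prod_zero_iff)
  also have "\<dots> \<longleftrightarrow> support x \<in> L"
    using x subset_closedD[OF L, of "support x"] by (auto simp: realization_def)
  also have "\<dots> \<longleftrightarrow> x \<in> realization L" using x by (auto simp: realization_def)
  finally show ?thesis .
qed

lemma continuous_on_collapse_map: "continuous_on S (collapse_map \<F>)"
proof (rule continuous_on_coordinatewise_then_product)
  have "continuous_on S (face_weight \<F>)"
    unfolding face_weight_def by (intro continuous_on_sum continuous_on_prod continuous_on_coord)
  then show "continuous_on S (\<lambda>x. collapse_map \<F> x i)" for i
    unfolding collapse_map_def by (cases i) (auto intro!: continuous_on_mult continuous_on_coord)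
qed

lemma collapse_map_eq_imp:
  assumes K: "finite K" "subset_closed K" and L: "subset_closed L"
    and xy: "x \<in> realization K" "y \<in> realization K" "collapse_map (K - L) x = collapse_map (K - L) y"
  shows "x = y \<or> x \<in> realization L \<and> y \<in> realization L"
proof -
  have weight: "face_weight (K - L) x = face_weight (K - L) y"
    using fun_cong[OF xy(3), of None] by (simp add: collapse_map_def)
  show ?thesis
  proof (cases "face_weight (K - L) x = 0")
    case True
    then show ?thesis
      using weight face_weight_eq_0_iff[OF K L xy(1)] face_weight_eq_0_iff[OF K L xy(2)] by simp
  next
    case False
    have "x v = y v" for v
      using fun_cong[OF xy(3), of "Some v"] weight False by (simp add: collapse_map_def)
    then show ?thesis by blast
  qed
qed

lemma homotopy_equivalent_Un_contractible:
  assumes K: "finite K" "subset_closed K" and L: "finite L" "subset_closed L"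
    and contractible: "contractible (realization L)" "contractible (realization (K \<inter> L))"
    and nonempty: "realization (K \<inter> L) \<noteq> {}"
  shows "realization (K \<union> L) homotopy_eqv realization K"
proof -
  let ?\<phi> = "collapse_map (K - L)"
  have closed: "subset_closed (K \<union> L)" "subset_closed (K \<inter> L)"
    using K(2) L(2) by (auto simp: subset_closed_def)
  have diff: "K - L = (K \<union> L) - L" "K - L = K - (K \<inter> L)" by auto
  have zero: "?\<phi> x = (\<lambda>_. 0)" if "x \<in> realization L" for x
  proof -
    have "x \<in> realization (K \<union> L)" using that by (simp add: realization_Un)
    then show ?thesis
      using that face_weight_eq_0_iff[OF _ closed(1) L(2)] K(1) L(1)
      by (simp add: collapse_map_def diff(1) fun_eq_iff)
  qed
  have inter: "realization (K \<inter> L) \<subseteq> realization L" by (intro realization_mono) auto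
  have "realization (K \<union> L) homotopy_eqv ?\<phi> ` realization (K \<union> L)"
  proof (rule homotopy_equivalent_collapse_subcomplex[OF _ closed(1) L(2) _ contractible(1)])
    show "continuous_on (realization (K \<union> L)) ?\<phi>" by (rule continuous_on_collapse_map)
    show "x = y \<or> x \<in> realization L \<and> y \<in> realization L"
      if "x \<in> realization (K \<union> L)" "y \<in> realization (K \<union> L)" "?\<phi> x = ?\<phi> y" for x y
      using collapse_map_eq_imp[OF _ closed(1) L(2)] that K(1) L(1) unfolding diff(1) by simp
  qed (use K(1) L(1) zero in auto)
  moreover have "realization K homotopy_eqv ?\<phi> ` realization K"
  proof (rule homotopy_equivalent_collapse_subcomplex[OF K closed(2) _ contractible(2)])
    show "continuous_on (realization K) ?\<phi>" by (rule continuous_on_collapse_map)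
    show "x = y \<or> x \<in> realization (K \<inter> L) \<and> y \<in> realization (K \<inter> L)"
      if "x \<in> realization K" "y \<in> realization K" "?\<phi> x = ?\<phi> y" for x y
      using collapse_map_eq_imp[OF K closed(2)] that unfolding diff(2) by simp
  qed (use zero subsetD[OF inter] in auto)
  moreover have "?\<phi> ` realization L \<subseteq> ?\<phi> ` realization K"
  proof -
    obtain x where "x \<in> realization (K \<inter> L)" using nonempty by blast
    then have "x \<in> realization K" "?\<phi> x = (\<lambda>_. 0)"
      using zero inter realization_mono[of "K \<inter> L" K] by auto
    then show ?thesis using zero by (metis (mono_tags, lifting) image_eqI image_subsetI)
  qed
  then have "?\<phi> ` realization (K \<union> L) = ?\<phi> ` realization K" by (auto simp: realization_Un image_Un)
  ultimately show ?thesis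
    by (metis homotopy_equivalent_space_sym homotopy_eqv_trans)
qed

lemma contractible_realization_cone:
  assumes K: "subset_closed K" and apex: "\<And>F. F \<in> K \<Longrightarrow> insert v F \<in> K"
  shows "contractible (realization K)"
proof -
  define a where "a u = (if u = v then 1 else 0 :: real)" for u
  define h where "h p u = (1 - fst p) * snd p u + fst p * a u" for p :: "real \<times> ('a \<Rightarrow> real)" and u
  have "h (t, x) \<in> realization K" if t: "t \<in> {0..1}" and x: "x \<in> realization K" for t x
  proof -
    let ?F = "insert v (support x)"
    have fin: "finite ?F" using finite_support[OF x] by simp
    have "x \<in> realization (Pow ?F)" using x by (auto simp: realization_def)
    then have "sum x ?F = 1" using realization_Pow_iff[OF fin] by blast
    moreover have "sum a ?F = 1" using fin by (simp add: a_def)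
    moreover have "sum (h (t, x)) ?F = (1 - t) * sum x ?F + t * sum a ?F"
      by (simp add: h_def sum.distrib sum_distrib_left del: sum.insert)
    ultimately have "sum (h (t, x)) ?F = 1" by (simp del: sum.insert)
    moreover have "0 \<le> h (t, x) u" for u using t x by (auto simp: h_def a_def realization_def)
    moreover have "h (t, x) u = 0" if "u \<notin> ?F" for u using that by (simp add: h_def a_def)
    ultimately have "h (t, x) \<in> realization (Pow ?F)" using realization_Pow_iff[OF fin] by blast
    moreover have "?F \<in> K" using apex x by (simp add: realization_def)
    ultimately show ?thesis using K realization_mono unfolding subset_closed_def by blast
  qed
  moreover have "continuous_on S h" for S
    unfolding h_def
    by (intro continuous_on_coordinatewise_then_product continuous_on_add continuous_on_mult
        continuous_on_diff continuous_on_const continuous_on_fst continuous_on_id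
        continuous_on_product_then_coordinatewise[OF continuous_on_snd[OF continuous_on_id]])
  ultimately have "homotopy_from (realization K) (realization K) id h"
    by (intro homotopy_fromI) (auto simp: h_def fun_eq_iff)
  then have "homotopic_with_canon (\<lambda>_. True) (realization K) (realization K) id (\<lambda>_. a)"
    by (rule homotopy_from_imp_homotopic) (simp add: h_def fun_eq_iff)
  then show ?thesis unfolding contractible_def by blast
qed

lemma nonevasive_complex:
  assumes "nonevasive K"
  shows "finite K" "subset_closed K" "realization K \<noteq> {}"
proof -
  have "finite K \<and> subset_closed K \<and> (\<exists>v. {v} \<in> K)"
    using assms
  proof (induction rule: nonevasive.induct)
    case (point x)
    have "subset_closed {{}, {x}}" by (auto simp: subset_closed_def subset_singleton_iff)
    then show ?case by auto
  next
    case (attach_cone K J x)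
    have "K \<union> insert x ` J = K \<union> (J \<union> insert x ` J)" using attach_cone.hyps(3) by blast
    then have "subset_closed (K \<union> insert x ` J)"
      using attach_cone.IH by (simp add: subset_closed_Un subset_closed_cone)
    then show ?case using attach_cone.IH by auto
  qed
  then obtain v where v: "{v} \<in> K" and "finite K" "subset_closed K" by blast
  then show "finite K" "subset_closed K" by blast+
  have "support (\<lambda>u. if u = v then 1 else 0) = {v}" by auto
  then have "(\<lambda>u. if u = v then 1 else 0) \<in> realization K" using v by (simp add: realization_def)
  then show "realization K \<noteq> {}" by blast
qed

theorem nonevasive_contractible:
  assumes "nonevasive K"
  shows "contractible (realization K)"
  using assms
proof (induction rule: nonevasive.induct)
  case (point x)
  show ?case
    using nonevasive_complex(2)[OF nonevasive.point]
    by (rule contractible_realization_cone[where v = x]) auto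
next
  case (attach_cone K J x)
  let ?L = "J \<union> insert x ` J"
  have union: "K \<union> insert x ` J = K \<union> ?L" and inter: "K \<inter> ?L = J"
    using attach_cone.hyps(3,4) by auto
  have J: "finite J" "subset_closed J" "realization J \<noteq> {}"
    using nonevasive_complex[OF attach_cone.hyps(2)] by blast+
  have "contractible (realization ?L)"
    by (rule contractible_realization_cone[OF subset_closed_cone[OF J(2)], of x]) auto
  then have "realization (K \<union> ?L) homotopy_eqv realization K"
    using J attach_cone.IH(2) nonevasive_complex[OF attach_cone.hyps(1)] inter
      subset_closed_cone[OF J(2), of x]
    by (intro homotopy_equivalent_Un_contractible) simp_all
  then show ?case
    using attach_cone.IH(1) union homotopy_equivalent_space_contractibility
      contractible_space_top_of_set by metis
qed

section \<open>Simplices modulo their boundaries\<close>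

text \<open>The sphere of radius \<open>1\<close> about \<open>(1, 0, \<dots>, 0)\<close>; it passes through the origin.\<close>
definition based_sphere :: "nat \<Rightarrow> (nat \<Rightarrow> real) set" where
  "based_sphere d = {p. (\<Sum>i\<le>d. (p i)\<^sup>2) = 2 * p 0 \<and> (\<forall>i>d. p i = 0)}"

definition block :: "nat \<Rightarrow> (nat \<Rightarrow> real) \<Rightarrow> nat \<times> nat \<Rightarrow> real" where
  "block j p = (\<lambda>(i, b). if i = j then p b else 0)"

lemma zero_in_based_sphere: "(\<lambda>_. 0) \<in> based_sphere d"
  by (simp add: based_sphere_def)

lemma block_0: "block j (\<lambda>_. 0) = (\<lambda>_. 0)"
  by (auto simp: block_def)

lemma block_eq_iff: "q \<noteq> (\<lambda>_. 0) \<Longrightarrow> block i p = block j q \<longleftrightarrow> i = j \<and> p = q"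
proof
  assume q: "q \<noteq> (\<lambda>_. 0)" and eq: "block i p = block j q"
  then obtain b where "q b \<noteq> 0" by (auto simp: fun_eq_iff)
  then have "i = j" using fun_cong[OF eq, of "(j, b)"] by (auto simp: block_def split: if_splits)
  moreover have "p b = q b" for b
    using fun_cong[OF eq, of "(i, b)"] \<open>i = j\<close> by (simp add: block_def)
  ultimately show "i = j \<and> p = q" by auto
qed simp

lemma block_sphere_eq_image: "block_sphere j d = block j ` based_sphere d"
proof -
  have expand: "(\<Sum>i\<le>d. (p i - (if i = 0 then 1 else 0))\<^sup>2) = (\<Sum>i\<le>d. (p i)\<^sup>2) - 2 * p 0 + 1"
    for p :: "nat \<Rightarrow> real"
  proof -
    have "(\<Sum>i\<le>d. (p i - (if i = 0 then 1 else 0))\<^sup>2) =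
        (\<Sum>i\<le>d. (p i)\<^sup>2 + (if i = 0 then 1 - 2 * p 0 else 0))"
      by (intro sum.cong) (auto simp: power2_eq_square algebra_simps)
    then show ?thesis by (simp add: sum.distrib)
  qed
  show ?thesis
  proof (intro Set.equalityI subsetI)
    fix x assume x: "x \<in> block_sphere j d"
    have "x = block j (\<lambda>b. x (j, b))" using x by (auto simp: block_sphere_def block_def fun_eq_iff)
    moreover have "(\<lambda>b. x (j, b)) \<in> based_sphere d"
      using x expand[of "\<lambda>b. x (j, b)"] by (simp add: block_sphere_def based_sphere_def)
    ultimately show "x \<in> block j ` based_sphere d" by blast
  next
    fix x assume "x \<in> block j ` based_sphere d"
    then obtain p where "p \<in> based_sphere d" "x = block j p" by blast
    then show "x \<in> block_sphere j d"
      using expand[of p] by (auto simp: block_sphere_def block_def based_sphere_def)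
  qed
qed

text \<open>The second intersection of the sphere with the line through the origin and \<open>q\<close>; by the
  convention \<open>x / 0 = 0\<close> it is the origin for \<open>q = 0\<close>.\<close>
definition sphere_point :: "nat \<Rightarrow> (nat \<Rightarrow> real) \<Rightarrow> nat \<Rightarrow> real" where
  "sphere_point d q b = (if b \<le> d then 2 * q 0 * q b / (\<Sum>i\<le>d. (q i)\<^sup>2) else 0)"

lemma based_sphere_pos:
  assumes "p \<in> based_sphere d" "p \<noteq> (\<lambda>_. 0)"
  shows "0 < p 0"
proof -
  obtain b where "p b \<noteq> 0" using assms(2) by (auto simp: fun_eq_iff)
  moreover from this have "b \<le> d"
    using assms(1) by (auto simp: based_sphere_def simp flip: not_less)
  ultimately have "0 < (\<Sum>i\<le>d. (p i)\<^sup>2)" by (intro sum_pos2[of _ b]) auto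
  then show ?thesis using assms(1) by (simp add: based_sphere_def)
qed

lemma sphere_point_in_based_sphere: "sphere_point d q \<in> based_sphere d"
proof -
  let ?s = "\<Sum>i\<le>d. (q i)\<^sup>2"
  have "(\<Sum>i\<le>d. (sphere_point d q i)\<^sup>2) = (\<Sum>i\<le>d. (2 * q 0 / ?s)\<^sup>2 * (q i)\<^sup>2)"
    by (intro sum.cong) (auto simp: sphere_point_def power_mult_distrib power_divide)
  also have "\<dots> = (2 * q 0 / ?s)\<^sup>2 * ?s" by (simp add: sum_distrib_left)
  also have "\<dots> = 2 * sphere_point d q 0" by (simp add: sphere_point_def power2_eq_square)
  finally show ?thesis by (simp add: based_sphere_def sphere_point_def)
qed

lemma sphere_point_eqI:
  assumes p: "p \<in> based_sphere d" "p \<noteq> (\<lambda>_. 0)" and q: "c \<noteq> 0" "\<And>b. b \<le> d \<Longrightarrow> q b = c * p b"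
  shows "sphere_point d q = p"
proof
  fix b
  have "(\<Sum>i\<le>d. (q i)\<^sup>2) = c\<^sup>2 * (\<Sum>i\<le>d. (p i)\<^sup>2)"
    unfolding sum_distrib_left using q(2) by (intro sum.cong) (auto simp: power_mult_distrib)
  also have "(\<Sum>i\<le>d. (p i)\<^sup>2) = 2 * p 0" using p(1) by (simp add: based_sphere_def)
  finally have "sphere_point d q b = (if b \<le> d then p b else 0)"
    using q based_sphere_pos[OF p] by (simp add: sphere_point_def power2_eq_square)
  then show "sphere_point d q b = p b" using p(1) by (simp add: based_sphere_def)
qed

lemma sphere_point_ratio:
  assumes "q 0 \<noteq> 0" "b \<le> d"
  shows "sphere_point d q b / sphere_point d q 0 = q b / q 0"
proof -
  have "0 < (\<Sum>i\<le>d. (q i)\<^sup>2)" using assms(1) by (intro sum_pos2[of _ 0]) auto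
  then show ?thesis using assms by (simp add: sphere_point_def)
qed

lemma simplex_interior_point_exists:
  assumes C: "finite C" "w \<in> C"
  obtains x where "x \<in> realization {C}" "\<And>v. v \<in> C \<Longrightarrow> x v - x w = min_coord C x * (r v - r w)"
proof -
  define y where "y v = r v - Min (r ` C) + 1" for v
  define T where "T = sum y C"
  define x where "x v = (if v \<in> C then y v / T else 0)" for v
  have y: "1 \<le> y v" if "v \<in> C" for v using that C(1) by (simp add: y_def)
  have "0 < T" unfolding T_def using y C by (intro sum_pos) force+
  have "support x = C" using y \<open>0 < T\<close> by (force simp: x_def)
  moreover have "sum x C = 1" using \<open>0 < T\<close> by (simp add: x_def T_def flip: sum_divide_distrib)
  moreover have "0 \<le> x v" for v using y[of v] \<open>0 < T\<close> by (auto simp: x_def)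
  ultimately have "x \<in> realization {C}" by (simp add: realization_def)
  have "Min (r ` C) \<in> r ` C" using C by (intro Min_in) auto
  then obtain u where u: "u \<in> C" "y u = 1" by (auto simp: y_def)
  have "min_coord C x = 1 / T"
    unfolding min_coord_def
  proof (rule Min_eqI)
    show "1 / T \<in> x ` C" using u by (auto simp: x_def image_iff intro!: bexI[of _ u])
    show "1 / T \<le> z" if "z \<in> x ` C" for z
      using that y \<open>0 < T\<close> by (auto simp: x_def divide_right_mono)
  qed (use C(1) in simp)
  then have "x v - x w = min_coord C x * (r v - r w)" if "v \<in> C" for v
    using that C(2) by (simp add: x_def y_def flip: diff_divide_distrib)
  then show ?thesis using that \<open>x \<in> realization {C}\<close> by blast
qed

lemma min_coord_pos: "finite C \<Longrightarrow> x \<in> realization {C} \<Longrightarrow> 0 < min_coord C x"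
  using min_coord_eq_0_iff[of C x] min_coord_nonneg[of C x] realization_mono[of "{C}" "Pow C"]
  by (force simp: realization_def)

lemma simplex_interior_point_unique:
  assumes C: "finite C" "w \<in> C" and x: "x \<in> realization {C}" and y: "y \<in> realization {C}"
    and gaps: "\<And>v. v \<in> C \<Longrightarrow> (x v - x w) / min_coord C x = (y v - y w) / min_coord C y"
  shows "x = y"
proof -
  let ?m = "min_coord C"
  have gap_eq: "z v / ?m z - z w / ?m z = (z v - z w) / ?m z" for z v
    by (simp add: diff_divide_distrib)
  have base_le: "z w / ?m z \<le> z' w / ?m z'" if z: "z \<in> realization {C}" "z' \<in> realization {C}"
      "\<And>v. v \<in> C \<Longrightarrow> (z v - z w) / ?m z = (z' v - z' w) / ?m z'" for z z'
  proof -
    have pos: "0 < ?m z" "0 < ?m z'" using min_coord_pos[OF C(1)] z by auto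
    have "C \<noteq> {}" using C(2) by blast
    then obtain u where u: "u \<in> C" "?m z = z u" using min_coord_attained[OF C(1)] by metis
    then have "z u / ?m z \<le> z' u / ?m z'" using min_coord_le[OF C(1) u(1), of z'] pos by simp
    then show ?thesis using z(3)[OF u(1)] gap_eq[of z u] gap_eq[of z' u] by linarith
  qed
  have base: "x w / ?m x = y w / ?m y"
    using base_le[of x y] base_le[of y x] x y gaps by (intro order_antisym) simp_all
  have scaled: "x v / ?m x = y v / ?m y" if "v \<in> C" for v
    using gaps[OF that] base gap_eq[of x v] gap_eq[of y v] by linarith
  have "support x = C" "support y = C" "sum x C = 1" "sum y C = 1"
    using x y by (auto simp: realization_def)
  moreover have "(\<Sum>v\<in>C. x v / ?m x) = (\<Sum>v\<in>C. y v / ?m y)"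
    using scaled by (intro sum.cong) auto
  ultimately have "1 / ?m x = 1 / ?m y" by (simp flip: sum_divide_distrib)
  moreover have "0 < ?m x" using min_coord_pos[OF C(1) x] .
  ultimately have "x v = y v" if "v \<in> C" for v using scaled[OF that] by simp
  moreover have "x v = 0" "y v = 0" if "v \<notin> C" for v
    using that \<open>support x = C\<close> \<open>support y = C\<close> by auto
  ultimately show ?thesis by fastforce
qed

definition boundary_quotient :: "'a set \<Rightarrow> (('a \<Rightarrow> real) \<Rightarrow> nat \<Rightarrow> real) \<Rightarrow> bool" where
  "boundary_quotient C \<sigma> \<longleftrightarrow> continuous_on (realization (Pow C)) \<sigma> \<and>
     bij_betw \<sigma> (realization {C}) (based_sphere (card C - 1) - {\<lambda>_. 0}) \<and>
     (\<forall>x\<in>realization (Pow C - {C}). \<sigma> x = (\<lambda>_. 0))"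

locale enumerated_simplex =
  fixes C :: "'a set" and d :: nat and e :: "nat \<Rightarrow> 'a"
  assumes bij_e: "bij_betw e {..d} C"
begin

text \<open>The direction in which the image of \<open>x\<close> is seen from the origin: in the interior, \<open>x\<close> is
  determined by the ratios \<open>gaps x b / gaps x 0\<close>, and \<open>gaps x 0\<close> vanishes on the boundary.\<close>
definition gaps :: "('a \<Rightarrow> real) \<Rightarrow> nat \<Rightarrow> real" where
  "gaps x b = (if b = 0 then min_coord C x else x (e b) - x (e 0))"

definition sphere_map :: "('a \<Rightarrow> real) \<Rightarrow> nat \<Rightarrow> real" where
  "sphere_map x = sphere_point d (gaps x)"

lemma finite_vertices: "finite C"
  using bij_betw_finite[OF bij_e] by simp

lemma first_vertex: "e 0 \<in> C"
  using bij_e by (auto simp: bij_betw_def)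

lemma vertex_iff: "v \<in> C \<longleftrightarrow> (\<exists>b\<le>d. v = e b)"
  using bij_e by (auto simp: bij_betw_def)

lemma sum_gaps_squared_pos:
  assumes x: "x \<in> realization (Pow C)"
  shows "0 < (\<Sum>b\<le>d. (gaps x b)\<^sup>2)"
proof (rule ccontr)
  assume "\<not> 0 < (\<Sum>b\<le>d. (gaps x b)\<^sup>2)"
  then have "(\<Sum>b\<le>d. (gaps x b)\<^sup>2) = 0"
    by (meson linorder_neqE_linordered_idom not_less sum_nonneg zero_le_power2)
  then have zero: "gaps x b = 0" if "b \<le> d" for b using that by (simp add: sum_nonneg_eq_0_iff)
  have "min_coord C x = 0" using zero[of 0] by (simp add: gaps_def)
  moreover have "C \<noteq> {}" using first_vertex by blast
  ultimately obtain u where u: "u \<in> C" "x u = 0"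
    using min_coord_attained[OF finite_vertices, of x] by metis
  have "x v = x (e 0)" if "v \<in> C" for v
  proof -
    obtain b where "b \<le> d" "v = e b" using \<open>v \<in> C\<close> vertex_iff by blast
    then show ?thesis using zero[of b] by (auto simp: gaps_def split: if_splits)
  qed
  then have "x v = 0" if "v \<in> C" for v using u that by metis
  then have "sum x C = 0" by simp
  then show False using x realization_Pow_iff[OF finite_vertices, of x] by simp
qed

lemma continuous_on_sphere_map: "continuous_on (realization (Pow C)) sphere_map"
proof (rule continuous_on_coordinatewise_then_product)
  fix b
  let ?S = "realization (Pow C)"
  have gaps: "continuous_on ?S (\<lambda>x. gaps x b)" for b
    unfolding gaps_def
    by (cases "b = 0")
      (auto intro: continuous_on_min_coord[OF finite_vertices continuous_on_id] continuous_on_diff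
        continuous_on_coord)
  have "(\<Sum>i\<le>d. (gaps x i)\<^sup>2) \<noteq> 0" if "x \<in> ?S" for x using sum_gaps_squared_pos[OF that] by simp
  then show "continuous_on ?S (\<lambda>x. sphere_map x b)"
    unfolding sphere_map_def sphere_point_def
    by (cases "b \<le> d")
      (auto intro!: continuous_on_divide continuous_on_mult continuous_on_sum continuous_on_power
        continuous_on_const gaps)
qed

lemma sphere_map_boundary: "x \<in> realization (Pow C - {C}) \<Longrightarrow> sphere_map x = (\<lambda>_. 0)"
proof -
  assume x: "x \<in> realization (Pow C - {C})"
  then have "x \<in> realization (Pow C)" "support x \<noteq> C" by (auto simp: realization_def)
  then have "min_coord C x = 0" using min_coord_eq_0_iff[OF finite_vertices] by blast
  then show ?thesis by (auto simp: sphere_map_def sphere_point_def gaps_def)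
qed

lemma sphere_map_ratio:
  assumes x: "x \<in> realization {C}" and b: "b \<le> d" "b \<noteq> 0"
  shows "sphere_map x b / sphere_map x 0 = (x (e b) - x (e 0)) / min_coord C x"
  using sphere_point_ratio[of "gaps x" b d] min_coord_pos[OF finite_vertices x] b
  by (simp add: sphere_map_def gaps_def)

lemma inj_on_sphere_map: "inj_on sphere_map (realization {C})"
proof (rule inj_onI)
  fix x y assume x: "x \<in> realization {C}" and y: "y \<in> realization {C}"
    and eq: "sphere_map x = sphere_map y"
  show "x = y"
  proof (rule simplex_interior_point_unique[OF finite_vertices first_vertex x y])
    fix v assume "v \<in> C"
    then obtain b where b: "b \<le> d" "v = e b" using vertex_iff by blast
    show "(x v - x (e 0)) / min_coord C x = (y v - y (e 0)) / min_coord C y"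
      using sphere_map_ratio[OF x b(1)] sphere_map_ratio[OF y b(1)] eq b(2) by (cases "b = 0") auto
  qed
qed

lemma sphere_map_nonzero: "x \<in> realization {C} \<Longrightarrow> sphere_map x \<noteq> (\<lambda>_. 0)"
proof -
  assume x: "x \<in> realization {C}"
  then have "0 < (\<Sum>b\<le>d. (gaps x b)\<^sup>2)"
    using sum_gaps_squared_pos realization_mono[of "{C}" "Pow C"] by blast
  then have "0 < sphere_map x 0"
    using min_coord_pos[OF finite_vertices x] by (simp add: sphere_map_def sphere_point_def gaps_def)
  then show ?thesis by auto
qed

lemma sphere_map_surj:
  assumes p: "p \<in> based_sphere d" "p \<noteq> (\<lambda>_. 0)"
  shows "p \<in> sphere_map ` realization {C}"
proof -
  define r where "r v = (if v = e 0 then 0 else p (inv_into {..d} e v) / p 0)" for v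
  obtain x where x: "x \<in> realization {C}"
    and gap: "\<And>v. v \<in> C \<Longrightarrow> x v - x (e 0) = min_coord C x * (r v - r (e 0))"
    using simplex_interior_point_exists[OF finite_vertices first_vertex] by metis
  have "sphere_map x = p"
    unfolding sphere_map_def
  proof (rule sphere_point_eqI[OF p])
    show "min_coord C x / p 0 \<noteq> 0"
      using min_coord_pos[OF finite_vertices x] based_sphere_pos[OF p] by simp
    fix b assume b: "b \<le> d"
    show "gaps x b = min_coord C x / p 0 * p b"
    proof (cases "b = 0")
      case True
      then show ?thesis using based_sphere_pos[OF p] by (simp add: gaps_def)
    next
      case False
      then have "e b \<noteq> e 0" using bij_betw_imp_inj_on[OF bij_e] b by (auto dest: inj_onD)
      moreover have "inv_into {..d} e (e b) = b" using bij_betw_inv_into_left[OF bij_e] b by simp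
      moreover have "e b \<in> C" using vertex_iff b by blast
      ultimately show ?thesis using False gap[of "e b"] by (simp add: gaps_def r_def)
    qed
  qed
  then show ?thesis using x by blast
qed

lemma bij_betw_sphere_map: "bij_betw sphere_map (realization {C}) (based_sphere d - {\<lambda>_. 0})"
  unfolding bij_betw_def
  using inj_on_sphere_map sphere_map_nonzero sphere_map_surj sphere_point_in_based_sphere
  by (auto simp: sphere_map_def)

end

theorem boundary_quotient_exists:
  assumes "finite C" "C \<noteq> {}"
  shows "\<exists>\<sigma>. boundary_quotient C \<sigma>"
proof -
  define d where "d = card C - 1"
  have "card C = Suc d" using assms by (simp add: d_def card_gt_0_iff)
  then obtain e where "bij_betw e {..d} C"
    using ex_bij_betw_nat_finite[OF assms(1)] by (auto simp: atLeast0LessThan lessThan_Suc_atMost)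
  then interpret enumerated_simplex C d e by unfold_locales
  have "boundary_quotient C sphere_map"
    using continuous_on_sphere_map bij_betw_sphere_map sphere_map_boundary
    by (simp add: boundary_quotient_def d_def)
  then show ?thesis by blast
qed

section \<open>Attaching facets to a contractible complex\<close>

locale facet_quotients =
  fixes K :: "'a set set" and Cs :: "'a set list" and \<sigma> :: "nat \<Rightarrow> ('a \<Rightarrow> real) \<Rightarrow> nat \<Rightarrow> real"
  assumes finite_K: "finite K" and subset_closed_K: "subset_closed K"
    and distinct_Cs: "distinct Cs" and Cs_facets: "set Cs \<subseteq> facets K"
    and quotient: "j < length Cs \<Longrightarrow> boundary_quotient (Cs ! j) (\<sigma> j)"
begin

definition wedge_map :: "('a \<Rightarrow> real) \<Rightarrow> nat \<times> nat \<Rightarrow> real" where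
  "wedge_map x = (\<lambda>(i, b). if i < length Cs \<and> support x = Cs ! i then \<sigma> i x b else 0)"

lemma continuous_on_\<sigma>: "j < length Cs \<Longrightarrow> continuous_on (realization (Pow (Cs ! j))) (\<sigma> j)"
  using quotient by (simp add: boundary_quotient_def)

lemma bij_betw_\<sigma>: "j < length Cs \<Longrightarrow>
    bij_betw (\<sigma> j) (realization {Cs ! j}) (based_sphere (card (Cs ! j) - 1) - {\<lambda>_. 0})"
  using quotient by (simp add: boundary_quotient_def)

lemma \<sigma>_boundary: "j < length Cs \<Longrightarrow> x \<in> realization (Pow (Cs ! j) - {Cs ! j}) \<Longrightarrow> \<sigma> j x = (\<lambda>_. 0)"
  using quotient by (simp add: boundary_quotient_def)

lemma nth_facet: "j < length Cs \<Longrightarrow> Cs ! j \<in> facets K"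
  using Cs_facets nth_mem by blast

lemma subset_closed_remainder: "subset_closed (K - set Cs)"
  unfolding subset_closed_def
proof (intro ballI subsetI)
  fix F G assume F: "F \<in> K - set Cs" and G: "G \<in> Pow F"
  have "F = G" if "G \<in> set Cs" using that Cs_facets F G by (auto simp: facets_def)
  then show "G \<in> K - set Cs" using F G subset_closedD[OF subset_closed_K, of F G] by auto
qed

lemma
  shows realization_open_facets:
      "realization K = realization (K - set Cs) \<union> (\<Union>j<length Cs. realization {Cs ! j})"
    and realization_closed_facets:
      "realization K = realization (K - set Cs) \<union> (\<Union>j<length Cs. realization (Pow (Cs ! j)))"
proof -
  have "set Cs \<subseteq> K" using Cs_facets by (auto simp: facets_def)
  then have "realization K = realization (K - set Cs) \<union> realization (set Cs)"
    by (simp flip: realization_Un add: Un_absorb2)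
  also have "realization (set Cs) = (\<Union>j<length Cs. realization {Cs ! j})"
    by (auto simp: realization_def in_set_conv_nth)
  finally show "realization K = realization (K - set Cs) \<union> (\<Union>j<length Cs. realization {Cs ! j})" .
  moreover have "realization (Pow (Cs ! j)) \<subseteq> realization K" if "j < length Cs" for j
    using nth_facet[OF that] subset_closed_K
    by (intro realization_mono) (auto simp: facets_def subset_closed_def)
  moreover have "realization {Cs ! j} \<subseteq> realization (Pow (Cs ! j))" for j
    by (intro realization_mono) auto
  ultimately show "realization K =
      realization (K - set Cs) \<union> (\<Union>j<length Cs. realization (Pow (Cs ! j)))" by blast
qed

lemma wedge_map_remainder: "x \<in> realization (K - set Cs) \<Longrightarrow> wedge_map x = (\<lambda>_. 0)"
  by (auto simp: wedge_map_def realization_def fun_eq_iff)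

lemma wedge_map_open_simplex:
  assumes "j < length Cs" "x \<in> realization {Cs ! j}"
  shows "wedge_map x = block j (\<sigma> j x)"
  using assms nth_eq_iff_index_eq[OF distinct_Cs]
  by (auto simp: wedge_map_def block_def realization_def fun_eq_iff)

lemma wedge_map_simplex:
  assumes j: "j < length Cs" and x: "x \<in> realization (Pow (Cs ! j))"
  shows "wedge_map x = block j (\<sigma> j x)"
proof (cases "support x = Cs ! j")
  case True
  then show ?thesis using wedge_map_open_simplex[OF j] x by (simp add: realization_def)
next
  case False
  have "support x \<subseteq> Cs ! j" "Cs ! j \<in> K"
    using x nth_facet[OF j] by (auto simp: realization_def facets_def)
  then have "support x \<notin> set Cs" using False Cs_facets by (auto simp: facets_def)
  then have "wedge_map x = (\<lambda>_. 0)" by (auto simp: wedge_map_def fun_eq_iff)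
  moreover have "\<sigma> j x = (\<lambda>_. 0)" using \<sigma>_boundary[OF j] x False by (simp add: realization_def)
  ultimately show ?thesis by (simp add: block_0)
qed

lemma continuous_on_wedge_map: "continuous_on (realization K) wedge_map"
proof -
  have "continuous_on (realization (K - set Cs)) (\<lambda>_. \<lambda>_. 0 :: real)" by (rule continuous_on_const)
  then have remainder: "continuous_on (realization (K - set Cs)) wedge_map"
    by (rule continuous_on_eq) (simp add: wedge_map_remainder)
  have finite_nth: "finite (Cs ! j)" if "j < length Cs" for j
    using finite_face[OF finite_K subset_closed_K] nth_facet[OF that] by (simp add: facets_def)
  have simplex: "continuous_on (realization (Pow (Cs ! j))) wedge_map" if j: "j < length Cs" for j
  proof -
    have "continuous_on (realization (Pow (Cs ! j))) (\<lambda>x. block j (\<sigma> j x))"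
    proof (rule continuous_on_coordinatewise_then_product)
      fix q :: "nat \<times> nat"
      have "continuous_on (realization (Pow (Cs ! j))) (\<lambda>x. \<sigma> j x (snd q))"
        by (rule continuous_on_product_then_coordinatewise[OF continuous_on_\<sigma>[OF j]])
      then show "continuous_on (realization (Pow (Cs ! j))) (\<lambda>x. block j (\<sigma> j x) q)"
        by (cases "fst q = j") (auto simp: block_def case_prod_beta)
    qed
    then show ?thesis by (rule continuous_on_eq) (simp add: wedge_map_simplex[OF j])
  qed
  have closed: "closed (realization (Pow (Cs ! j)))" if "j < length Cs" for j
    by (rule compact_imp_closed_fun[OF compact_realization_Pow[OF finite_nth[OF that]]])
  show ?thesis
    unfolding realization_closed_facets
  proof (rule continuous_on_closed_Un[OF _ _ remainder])
    show "closed (realization (K - set Cs))"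
      using finite_K by (intro closed_realization subset_closed_remainder) auto
    show "closed (\<Union>j<length Cs. realization (Pow (Cs ! j)))"
      using closed by (auto intro!: closed_UN)
    show "continuous_on (\<Union>j<length Cs. realization (Pow (Cs ! j))) wedge_map"
      using closed simplex by (intro continuous_on_closed_Union) auto
  qed
qed

lemma wedge_map_image:
  assumes "realization (K - set Cs) \<noteq> {}"
  shows "wedge_map ` realization K =
    insert (\<lambda>_. 0) (\<Union>j<length Cs. block_sphere j (card (Cs ! j) - 1))"
proof -
  let ?S = "\<lambda>j. based_sphere (card (Cs ! j) - 1)"
  have "wedge_map ` realization {Cs ! j} = block j ` (?S j - {\<lambda>_. 0})" if j: "j < length Cs" for j
  proof -
    have "wedge_map ` realization {Cs ! j} = (\<lambda>x. block j (\<sigma> j x)) ` realization {Cs ! j}"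
      using wedge_map_open_simplex[OF j] by (rule image_cong[OF refl])
    also have "\<dots> = block j ` \<sigma> j ` realization {Cs ! j}" by (simp add: image_image)
    finally show ?thesis using bij_betw_imp_surj_on[OF bij_betw_\<sigma>[OF j]] by simp
  qed
  moreover have "wedge_map ` realization (K - set Cs) = {\<lambda>_. 0}"
    using assms wedge_map_remainder by (auto simp: image_iff)
  ultimately have "wedge_map ` realization K =
      insert (\<lambda>_. 0) (\<Union>j<length Cs. block j ` (?S j - {\<lambda>_. 0}))"
    unfolding realization_open_facets by (simp add: image_Un image_UN)
  moreover have "block j ` ?S j = insert (\<lambda>_. 0) (block j ` (?S j - {\<lambda>_. 0}))" for j
    using block_0[of j] by (metis image_insert insert_Diff zero_in_based_sphere)
  then have "insert (\<lambda>_. 0) (\<Union>j<length Cs. block j ` (?S j - {\<lambda>_. 0})) =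
      insert (\<lambda>_. 0) (\<Union>j<length Cs. block j ` ?S j)" by simp
  ultimately show ?thesis by (simp add: block_sphere_eq_image)
qed

lemma wedge_map_eq_imp:
  assumes "x \<in> realization K" "y \<in> realization K" "wedge_map x = wedge_map y"
  shows "x = y \<or> x \<in> realization (K - set Cs) \<and> y \<in> realization (K - set Cs)"
proof -
  have nonzero: "\<sigma> j z \<noteq> (\<lambda>_. 0)" if "j < length Cs" "z \<in> realization {Cs ! j}" for j z
    using bij_betw_apply[OF bij_betw_\<sigma>[OF that(1)] that(2)] by simp
  then have block_nonzero: "block j (\<sigma> j z) \<noteq> (\<lambda>_. 0)"
    if "j < length Cs" "z \<in> realization {Cs ! j}" for j z
    using that block_eq_iff[of "\<sigma> j z" j "\<lambda>_. 0" j] block_0[of j] by metis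
  consider (neither) "x \<in> realization (K - set Cs)" "y \<in> realization (K - set Cs)"
    | (first) j where "j < length Cs" "x \<in> realization {Cs ! j}" "y \<in> realization (K - set Cs)"
    | (second) j where "j < length Cs" "y \<in> realization {Cs ! j}" "x \<in> realization (K - set Cs)"
    | (both) i j where "i < length Cs" "x \<in> realization {Cs ! i}"
        "j < length Cs" "y \<in> realization {Cs ! j}"
    using assms(1,2) unfolding realization_open_facets by blast
  then show ?thesis
  proof cases
    case (both i j)
    then have "block i (\<sigma> i x) = block j (\<sigma> j y)" using assms(3) wedge_map_open_simplex by simp
    then have "i = j" "\<sigma> i x = \<sigma> j y" using block_eq_iff[OF nonzero] both by auto
    then show ?thesis
      using bij_betw_imp_inj_on[OF bij_betw_\<sigma>[OF both(1)]] both by (auto dest: inj_onD)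
  qed (use assms(3) block_nonzero wedge_map_open_simplex wedge_map_remainder in auto)
qed

end

theorem contractible_attach_facets_wedge:
  assumes K: "finite K" "subset_closed K" and \<C>: "\<C> \<subseteq> facets K"
    and contractible: "contractible (realization (K - \<C>))"
    and nonempty: "realization (K - \<C>) \<noteq> {}"
  shows "\<exists>ds. top_of_set (realization K) homotopy_equivalent_space wedge_spheres ds"
proof -
  have "\<C> \<subseteq> K" using \<C> by (auto simp: facets_def)
  then obtain Cs where set_Cs: "set Cs = \<C>" and "distinct Cs"
    using K(1) finite_subset finite_distinct_list by metis
  have "\<exists>\<sigma>. boundary_quotient C \<sigma>" if "C \<in> \<C>" for C
  proof (rule boundary_quotient_exists)
    show "finite C" using finite_face[OF K] that \<open>\<C> \<subseteq> K\<close> by blast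
    obtain x where x: "x \<in> realization (K - \<C>)" using nonempty by blast
    then have "support x \<in> K" by (simp add: realization_def)
    moreover have "C \<in> facets K" using that \<C> by blast
    ultimately have "support x = C" if "C \<subseteq> support x" using that by (simp add: facets_def)
    then show "C \<noteq> {}" using support_nonempty[OF x] by auto
  qed
  then obtain \<sigma> where \<sigma>: "\<And>C. C \<in> \<C> \<Longrightarrow> boundary_quotient C (\<sigma> C)" by metis
  interpret facet_quotients K Cs "\<lambda>j. \<sigma> (Cs ! j)"
    using K set_Cs \<open>distinct Cs\<close> \<C> \<sigma> by unfold_locales auto
  have "realization K homotopy_eqv wedge_map ` realization K"
    using contractible wedge_map_eq_imp wedge_map_remainder
    by (intro homotopy_equivalent_collapse_subcomplex[OF K subset_closed_remainder _ _
          continuous_on_wedge_map]) (simp_all add: set_Cs)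
  also have "wedge_map ` realization K =
      insert (\<lambda>_. 0) (\<Union>j<length Cs. block_sphere j (card (Cs ! j) - 1))"
    using nonempty by (intro wedge_map_image) (simp add: set_Cs)
  also have "top_of_set \<dots> = wedge_spheres (map (\<lambda>C. card C - 1) Cs)"
    by (simp add: wedge_spheres_def)
  finally show ?thesis by blast
qed

section \<open>Homotopy type of the intersection lattice\<close>

lemma maximal_chain_in_imp_facet:
  assumes "C \<in> order_chains P" "maximal_chain_in Q C" "P \<subseteq> Q"
  shows "C \<in> facets (order_chains P)"
  unfolding facets_def
proof (intro CollectI conjI ballI impI)
  fix F assume F: "F \<in> order_chains P" "C \<subseteq> F"
  show "F = C"
  proof (rule ccontr)
    assume "F \<noteq> C"
    then obtain z where z: "z \<in> F" "z \<notin> C" using F(2) by blast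
    then have "C \<subseteq> link UNIV z"
      using F by (auto simp: order_complex_def link_def order.order_iff_strict)
    then show False
      using assms(2,3) z(1) F(1) by (auto simp: maximal_chain_in_def order_complex_def)
  qed
qed (rule assms(1))

theorem almost_nonevasive_imp_wedge_of_spheres:
  assumes "finite P" "P \<subseteq> Q" "almost_nonevasive Q P"
  shows "htype_wedge_of_spheres (top_of_set (geom_realization P (order_chains P)))"
proof (cases "Q = {}")
  case True
  then show ?thesis using assms(2) by (simp add: htype_wedge_of_spheres_def geom_realization_def)
next
  case False
  then obtain \<C> where \<C>: "\<C> \<subseteq> order_chains P" "\<And>C. C \<in> \<C> \<Longrightarrow> maximal_chain_in Q C"
    "nonevasive (order_chains P - \<C>)"
    using assms(3) unfolding almost_nonevasive_def by blast
  have "order_chains P \<subseteq> Pow P" by (auto simp: order_complex_def)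
  then have "finite (order_chains P)" using assms(1) finite_subset by auto
  moreover have "subset_closed (order_chains P)"
    by (auto simp: subset_closed_def order_complex_def intro: finite_subset)
  moreover have "\<C> \<subseteq> facets (order_chains P)"
    using maximal_chain_in_imp_facet[OF _ _ assms(2)] \<C>(1,2) by blast
  ultimately have
    "\<exists>ds. top_of_set (realization (order_chains P)) homotopy_equivalent_space wedge_spheres ds"
    using contractible_attach_facets_wedge nonevasive_contractible[OF \<C>(3)]
      nonevasive_complex(3)[OF \<C>(3)] by blast
  moreover have "geom_realization P (order_chains P) = realization (order_chains P)"
    using \<open>order_chains P \<subseteq> Pow P\<close> by (intro geom_realization_eq_realization assms(1)) auto
  ultimately show ?thesis unfolding htype_wedge_of_spheres_def by simp
qed

lemma inner_meets_subset: "inner_meets b A \<subseteq> meets b A \<inter> {inf b (Inf A)<..<b}"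
  using meets_le meets_ge by (fastforce simp: inner_meets_def order.strict_iff_order)

lemma proper_part_eq_inner_meets: "proper_part n \<Delta> = inner_meets (Rn n) (diag_arrangement n \<Delta>)"
  by (simp add: proper_part_def inner_meets_def intersection_lattice_eq_meets lattice_bot_def
      lattice_top_def)

theorem theorem1p1:
  fixes n :: nat and \<Delta> :: "nat set set"
  assumes "simplicial_complex_on n \<Delta>"
    and "shellable \<Delta>"
    and "cx_dim_le \<Delta> (int n - 3)"
  shows "htype_wedge_of_spheres
           (top_of_set (geom_realization (proper_part n \<Delta>)
              (order_complex (proper_part n \<Delta>) (\<lambda>x y. y \<subseteq> x))))"
proof -
  let ?A = "diag_arrangement n \<Delta>" and ?P = "proper_part n \<Delta>"
  let ?Q = "meets (Rn n) ?A \<inter> {inf (Rn n) (Inf ?A)<..<Rn n}"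
  have "finite ?A"
    using finite_simplicial_complex[OF assms(1)] by (simp add: diag_arrangement_def facets_def)
  moreover have "shelled (meets (Rn n) ?A) (Rn n) ?A"
    using shelled_diag_arrangement[OF assms] by (simp add: intersection_lattice_eq_meets)
  ultimately have "almost_nonevasive ?Q ?P"
    unfolding proper_part_eq_inner_meets by (rule shelled_imp_almost_nonevasive)
  moreover have "?P \<subseteq> ?Q" unfolding proper_part_eq_inner_meets by (rule inner_meets_subset)
  moreover have "finite ?P"
    using \<open>?P \<subseteq> ?Q\<close> finite_meets[OF \<open>finite ?A\<close>] by (meson finite_Int finite_subset)
  ultimately show ?thesis by (intro almost_nonevasive_imp_wedge_of_spheres)
qed

end
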